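(* Let $K:\mathbb R\to\mathbb R$ be a symmetric, Lipschitz function supported in $[-1,1]$ with $\int K=1$ and with $\widehat K\in L^4(\mathbb R)$. Let $q\ge 1$ be an integer and $0<h<1/4$. Put $\kappa=K\star K$, $R(K)=\int K^2=\kappa(0)$, $\|\kappa\|_2^2=\int\kappa^2=\int|\widehat K|^4$, $$\Sigma_q(h)=\frac1q\sum_{r=0}^{q-1}\kappa^2\Bigl(\frac{\min(r,q-r)}{qh}\Bigr),\qquad r_q(h)=\frac{R(K)^2}{\Sigma_q(h)}.$$ Then $$\Sigma_q(h)=h\sum_{k\in\mathbb Z}\widehat{\kappa^2}(kqh)=h\|\kappa\|_2^2+2h\sum_{k\ge1}\widehat{\kappa^2}(kqh),$$ and every term of the series is non-negative. Consequently $$r_q(h)\le\min\Bigl(q,\frac{c_K}{h}\Bigr),\qquad c_K:=\frac{R(K)^2}{\|\kappa\|_2^2}=\frac{(\int K^2)^2}{\int|\widehat K|^4},$$ and the bound is attained at both ends: $r_q(h)=q$ exactly whenever $qh<1/2$, and $r_q(h)\,h\to c_K$ as $qh\to\infty$.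
   Context: Fourier transform convention: $\widehat g(\xi)=\int_{\mathbb R} g(x)e^{-2\pi i x\xi}\,dx$. The symbol $\star$ denotes convolution on $\mathbb R$. $\widehat{\kappa^2}$ is the Fourier transform of the function $x\mapsto\kappa(x)^2$. *)

theory Defs
  imports "HOL-Analysis.Analysis"
begin

definition fourier_transform :: "(real \<Rightarrow> complex) \<Rightarrow> real \<Rightarrow> complex" where
  "fourier_transform g \<xi> =
     (LINT x|lborel. g x * exp (- 2 * complex_of_real pi * \<i> * complex_of_real x * complex_of_real \<xi>))"

definition real_conv :: "(real \<Rightarrow> real) \<Rightarrow> (real \<Rightarrow> real) \<Rightarrow> real \<Rightarrow> real" where
  "real_conv f g x = (LINT y|lborel. f y * g (x - y))"

definition kap :: "(real \<Rightarrow> real) \<Rightarrow> real \<Rightarrow> real" where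
  "kap K = real_conv K K"

definition K_hat :: "(real \<Rightarrow> real) \<Rightarrow> real \<Rightarrow> complex" where
  "K_hat K = fourier_transform (\<lambda>x. complex_of_real (K x))"

definition kap_sq_hat :: "(real \<Rightarrow> real) \<Rightarrow> real \<Rightarrow> complex" where
  "kap_sq_hat K = fourier_transform (\<lambda>x. complex_of_real ((kap K x)\<^sup>2))"

definition RK :: "(real \<Rightarrow> real) \<Rightarrow> real" where
  "RK K = (LINT x|lborel. (K x)\<^sup>2)"

definition kap_norm_sq :: "(real \<Rightarrow> real) \<Rightarrow> real" where
  "kap_norm_sq K = (LINT x|lborel. (kap K x)\<^sup>2)"

definition Sigma_q :: "(real \<Rightarrow> real) \<Rightarrow> nat \<Rightarrow> real \<Rightarrow> real" where
  "Sigma_q K q h =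
     1 / real q * (\<Sum>r<q. (kap K (min (real r) (real q - real r) / (real q * h)))\<^sup>2)"

definition r_q :: "(real \<Rightarrow> real) \<Rightarrow> nat \<Rightarrow> real \<Rightarrow> real" where
  "r_q K q h = (RK K)\<^sup>2 / Sigma_q K q h"

definition c_const :: "(real \<Rightarrow> real) \<Rightarrow> real" where
  "c_const K = (RK K)\<^sup>2 / kap_norm_sq K"

(* The limit "q h \<rightarrow> \<infinity>" is a joint one: both q and h may vary, within q \<ge> 1 and 0 < h < 1/4. *)
definition qh_at_top :: "(nat \<times> real) filter" where
  "qh_at_top = inf (filtercomap (\<lambda>(q, h). real q * h) at_top)
                   (principal {(q, h). 1 \<le> q \<and> 0 < h \<and> h < 1 / 4})"

end

theory Submission
  imports Defs
begin

text \<open>The grid sum in \<open>Sigma_q\<close> is a sum of \<open>\<kappa>\<^sup>2\<close> over a lattice of spacing \<open>1/(q h)\<close>, because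
  \<open>h < 1/4\<close> keeps the support of \<open>\<kappa>\<^sup>2\<close> away from the fold at \<open>r = q/2\<close>. Poisson summation
  gives the dual series; its terms are non-negative because \<open>\<kappa>\<^sup>2\<close> is an average of
  autocorrelations. Poisson summation needs only convergence of symmetric partial sums of
  the Fourier series of a Lipschitz periodization at \<open>0\<close>; non-negativity then upgrades this to
  unconditional summability. Plancherel's identity also comes from Poisson summation, applied to the
  modulations of \<open>\<kappa> \<star> \<kappa>\<close> and averaged over the modulation frequency. The limit is the
  convergence of Riemann sums.\<close>

section \<open>Lipschitz functions of compact support\<close>

text \<open>One class, \<open>lip_supp\<close>, carries the whole argument: it contains
  \<open>K\<close> and is closed under convolution, squares, dilations and modulations, and its
  members have Lipschitz periodizations. No decay of the transform of \<kappa>^2 is available at the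
  start, so absolute convergence of the dual series has to come out of positivity. Positivity is
  obtained on the space side. Squaring \<kappa>(x) gives the double integral of K(y) K(x - y) K(z)
  K(x - z); with z = y + t and t fixed, the integral over y is the autocorrelation at x of the
  product of K and its translate by t. All integrands are bounded with bounded support, so Fubini
  applies. Both bounds on \<open>r_q\<close> keep a single term of a sum of non-negative terms: r =
  0 in the grid sum, k = 0 in the dual series. They are attained because the other terms vanish (qh
  < 1/2) or become negligible against the one kept (qh to infinity). The L^4 hypothesis enters
  through Plancherel's identity, as integrability in frequency.\<close>

definition lip_supp :: "real \<Rightarrow> real \<Rightarrow> (real \<Rightarrow> 'a::real_normed_vector) \<Rightarrow> bool" where
  "lip_supp L A f \<longleftrightarrow> L-lipschitz_on UNIV f \<and> (\<forall>x. A < \<bar>x\<bar> \<longrightarrow> f x = 0)"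

lemma lip_supp_norm_diff_le:
  "lip_supp L A f \<Longrightarrow> norm (f x - f y) \<le> L * \<bar>x - y\<bar>"
  unfolding lip_supp_def lipschitz_on_def dist_norm by auto

lemma lip_supp_eq_0: "lip_supp L A f \<Longrightarrow> A < \<bar>x\<bar> \<Longrightarrow> f x = 0"
  by (simp add: lip_supp_def)

lemma lip_supp_nonneg: "lip_supp L A f \<Longrightarrow> 0 \<le> L"
  by (auto simp: lip_supp_def lipschitz_on_def)

lemma lip_suppI:
  assumes "0 \<le> L" "\<And>x y. norm (f x - f y) \<le> L * \<bar>x - y\<bar>" "\<And>x. A < \<bar>x\<bar> \<Longrightarrow> f x = 0"
  shows "lip_supp L A f"
  using assms by (auto simp: lip_supp_def lipschitz_on_def dist_norm)

lemma lip_supp_bounded: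
  assumes "lip_supp L A f"
  obtains B where "0 \<le> B" "\<And>x. norm (f x) \<le> B"
proof
  have L: "0 \<le> L" using assms by (rule lip_supp_nonneg)
  \<comment> \<open>\<open>f\<close> vanishes at |A| + 1, and this point is at distance at most 2|A|
    + 1 from any point of [-A, A]. The absolute value covers negative \<open>A\<close>.\<close>
  show "0 \<le> L * (2 * \<bar>A\<bar> + 1)" using L by simp
  fix x
  show "norm (f x) \<le> L * (2 * \<bar>A\<bar> + 1)"
  proof (cases "\<bar>x\<bar> \<le> A")
    case True
    have "f (\<bar>A\<bar> + 1) = 0" using assms by (rule lip_supp_eq_0) auto
    then have "norm (f x) \<le> L * \<bar>x - (\<bar>A\<bar> + 1)\<bar>"
      using lip_supp_norm_diff_le[OF assms, of x "\<bar>A\<bar> + 1"] by simp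
    also have "\<dots> \<le> L * (2 * \<bar>A\<bar> + 1)"
      using True L by (intro mult_left_mono) auto
    finally show ?thesis .
  next
    case False
    then have "f x = 0" using lip_supp_eq_0[OF assms] by auto
    then show ?thesis using L by simp
  qed
qed

lemma lip_supp_continuous: "lip_supp L A f \<Longrightarrow> continuous_on UNIV f"
  by (auto simp: lip_supp_def intro: lipschitz_on_continuous_on)

lemma lip_supp_measurable: "lip_supp L A f \<Longrightarrow> f \<in> borel_measurable borel"
  by (intro borel_measurable_continuous_onI lip_supp_continuous)

lemma lip_supp_of_real:
  "lip_supp L A f \<Longrightarrow> lip_supp L A (\<lambda>x. of_real (f x) :: 'a::real_normed_algebra_1)"
  unfolding lip_supp_def lipschitz_on_def dist_norm by (auto simp flip: of_real_diff)

text \<open>Only \<open>f\<close> carries the support condition, so that \<open>g\<close> can be a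
  character, which gives the modulations, or \<open>f\<close> itself, which gives squares.\<close>

lemma lip_supp_mult:
  fixes f g :: "real \<Rightarrow> 'a::real_normed_algebra"
  assumes f: "lip_supp L A f" and g: "M-lipschitz_on UNIV g" and B: "\<And>x. norm (g x) \<le> B"
  shows "\<exists>L'. lip_supp L' A (\<lambda>x. f x * g x)"
proof -
  obtain C where C: "0 \<le> C" "\<And>x. norm (f x) \<le> C" using lip_supp_bounded[OF f] by blast
  have L: "0 \<le> L" using f by (rule lip_supp_nonneg)
  have M: "0 \<le> M" using g by (rule lipschitz_on_nonneg)
  have B0: "0 \<le> B" using B[of 0] norm_ge_zero order_trans by blast
  have "lip_supp (C * M + L * B) A (\<lambda>x. f x * g x)"
  proof (rule lip_suppI)
    show "0 \<le> C * M + L * B" using C L M B0 by simp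
    fix x y
    have "f x * g x - f y * g y = f x * (g x - g y) + (f x - f y) * g y"
      by (simp add: algebra_simps)
    then have "norm (f x * g x - f y * g y) \<le> norm (f x) * norm (g x - g y) + norm (f x - f y) * norm (g y)"
      by (metis add_mono norm_mult_ineq norm_triangle_le)
    also have "\<dots> \<le> C * (M * \<bar>x - y\<bar>) + (L * \<bar>x - y\<bar>) * B"
      using C L B0 B lip_supp_norm_diff_le[OF f, of x y] lipschitz_onD[OF g, of x y]
      by (intro add_mono mult_mono) (auto simp: dist_norm)
    finally show "norm (f x * g x - f y * g y) \<le> (C * M + L * B) * \<bar>x - y\<bar>"
      by (simp add: algebra_simps)
  next
    fix x :: real assume "A < \<bar>x\<bar>"
    then show "f x * g x = 0" using lip_supp_eq_0[OF f] by simp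
  qed
  then show ?thesis ..
qed

lemma lip_supp_power2:
  fixes f :: "real \<Rightarrow> 'a::real_normed_algebra_1"
  assumes f: "lip_supp L A f"
  shows "\<exists>L'. lip_supp L' A (\<lambda>x. (f x)\<^sup>2)"
proof -
  obtain C where "\<And>x. norm (f x) \<le> C" using lip_supp_bounded[OF f] by blast
  then have "\<exists>L'. lip_supp L' A (\<lambda>x. f x * f x)"
    using f by (intro lip_supp_mult[OF f, where M = L and B = C]) (auto simp: lip_supp_def)
  then show ?thesis by (simp add: power2_eq_square)
qed

text \<open>With T = qh the lattice of spacing 1/(qh) becomes the integers. The Lipschitz constant
  shrinks like 1/T while the support grows like T, and this balance gives the rate in the
  limit.\<close>

lemma lip_supp_scale:
  assumes f: "lip_supp L A f" and T: "0 < T"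
  shows "lip_supp (L / T) (A * T) (\<lambda>x. f (x / T))"
proof (rule lip_suppI)
  show "0 \<le> L / T" using lip_supp_nonneg[OF f] T by simp
  fix x y
  have "norm (f (x / T) - f (y / T)) \<le> L * \<bar>x / T - y / T\<bar>"
    by (rule lip_supp_norm_diff_le[OF f])
  also have "\<bar>x / T - y / T\<bar> = \<bar>x - y\<bar> / T"
    using T by (simp flip: diff_divide_distrib)
  finally show "norm (f (x / T) - f (y / T)) \<le> L / T * \<bar>x - y\<bar>" by simp
next
  fix x :: real assume "A * T < \<bar>x\<bar>"
  then have "A < \<bar>x / T\<bar>" using T by (simp add: field_simps)
  then show "f (x / T) = 0" by (rule lip_supp_eq_0[OF f])
qed

text \<open>Stated for any Euclidean space so that it also serves on the plane, in
  \<open>Fubini_bounded_support\<close>.\<close>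

lemma integrable_bounded_support:
  fixes f :: "'a::euclidean_space \<Rightarrow> 'b::{banach, second_countable_topology}"
  assumes "f \<in> borel_measurable borel" "\<And>x. norm (f x) \<le> B" "\<And>x. r < norm x \<Longrightarrow> f x = 0"
  shows "integrable lborel f"
proof (rule Bochner_Integration.integrable_bound)
  show "integrable lborel (\<lambda>x. indicator (cball 0 r) x * B :: real)"
    using emeasure_lborel_cball_finite[of 0 r]
    by (intro integrable_mult_left integrable_real_indicator) auto
  show "f \<in> borel_measurable lborel" using assms(1) by simp
  show "AE x in lborel. norm (f x) \<le> norm (indicator (cball 0 r) x * B :: real)"
  proof (rule AE_I2)
    fix x :: 'a
    show "norm (f x) \<le> norm (indicator (cball 0 r) x * B)"
      using assms(2)[of x] assms(3)[of x] by (auto split: split_indicator)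
  qed
qed

lemma lip_supp_integrable:
  fixes f :: "real \<Rightarrow> 'a::{banach, second_countable_topology}"
  assumes "lip_supp L A f"
  shows "integrable lborel f"
proof -
  obtain B where "\<And>x. norm (f x) \<le> B" using lip_supp_bounded[OF assms] by blast
  then show ?thesis
    using lip_supp_measurable[OF assms] lip_supp_eq_0[OF assms]
    by (intro integrable_bounded_support[where r = A]) auto
qed

lemma Fubini_bounded_support:
  fixes f :: "real \<Rightarrow> real \<Rightarrow> 'b::{banach, second_countable_topology}"
  assumes m: "(\<lambda>p. f (fst p) (snd p)) \<in> borel_measurable (borel \<Otimes>\<^sub>M borel)"
    and b: "\<And>x y. norm (f x y) \<le> B"
    and s: "\<And>x y. A < \<bar>x\<bar> \<or> A < \<bar>y\<bar> \<Longrightarrow> f x y = 0"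
  shows "(LINT x|lborel. LINT y|lborel. f x y) = (LINT y|lborel. LINT x|lborel. f x y)"
proof -
  have "integrable lborel (\<lambda>p. f (fst p) (snd p))"
  proof (rule integrable_bounded_support[where r = "2 * A"])
    fix p :: "real \<times> real" assume "2 * A < norm p"
    moreover have "norm p \<le> \<bar>fst p\<bar> + \<bar>snd p\<bar>"
      using norm_Pair_le[of "fst p" "snd p"] by simp
    ultimately have "A < \<bar>fst p\<bar> \<or> A < \<bar>snd p\<bar>" by linarith
    then show "f (fst p) (snd p) = 0" by (rule s)
  qed (use m b in \<open>auto simp: borel_prod\<close>)
  then have "integrable (lborel \<Otimes>\<^sub>M lborel) (case_prod f)"
    by (simp add: lborel_prod case_prod_beta')
  then show ?thesis
    by (rule lborel_pair.Fubini_integral[symmetric])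
qed

lemma norm_integral_bounded_support:
  fixes f :: "real \<Rightarrow> 'b::{banach, second_countable_topology}"
  assumes "\<And>x. norm (f x) \<le> B" "\<And>x. A < \<bar>x\<bar> \<Longrightarrow> f x = 0" "0 \<le> A" "0 \<le> B"
  shows "norm (LINT x|lborel. f x) \<le> 2 * A * B"
proof (cases "integrable lborel f")
  case True
  have "norm (LINT x|lborel. f x) \<le> (LINT x|lborel. norm (f x))"
    by (rule integral_norm_bound)
  also have "\<dots> \<le> (LINT x|lborel. indicator {-A..A} x * B)"
  proof (rule integral_mono)
    show "integrable lborel (\<lambda>x. norm (f x))" using True by simp
    show "integrable lborel (\<lambda>x. indicator {- A..A} x * B)"
      using assms by (intro integrable_mult_left integrable_real_indicator) auto
    show "norm (f x) \<le> indicator {-A..A} x * B" for x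
      using assms(1)[of x] assms(2)[of x] by (auto split: split_indicator)
  qed
  also have "\<dots> = 2 * A * B" using assms by simp
  finally show ?thesis .
next
  \<comment> \<open>A non-integrable function has integral \<open>0\<close> by convention, and the
    bound is non-negative.\<close>
  case False
  then show ?thesis using assms by (simp add: not_integrable_integral_eq)
qed

text \<open>The variable of the convolution enters through \<open>g\<close> alone, so an increment
  is an integral of \<open>f\<close> against an increment of \<open>g\<close>; its size is at most
  2|A| times the bound of \<open>f\<close> times the Lipschitz bound of \<open>g\<close>.\<close>

lemma lip_supp_real_conv:
  assumes f: "lip_supp L A f" and g: "lip_supp M C g"
  shows "\<exists>L'. lip_supp L' (A + C) (real_conv f g)"
proof -
  obtain B where B: "0 \<le> B" "\<And>x. norm (f x) \<le> B" using lip_supp_bounded[OF f] by blast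
  obtain D where D: "0 \<le> D" "\<And>x. norm (g x) \<le> D" using lip_supp_bounded[OF g] by blast
  have M: "0 \<le> M" using g by (rule lip_supp_nonneg)
  note [measurable] = lip_supp_measurable[OF f] lip_supp_measurable[OF g]
  have int: "integrable lborel (\<lambda>y. f y * g (x - y))" for x
  proof (rule integrable_bounded_support[where r = "A" and B = "B * D"])
    show "norm (f y * g (x - y)) \<le> B * D" for y
      unfolding norm_mult using B D by (intro mult_mono) auto
  qed (use lip_supp_eq_0[OF f] in auto)
  have "lip_supp (2 * \<bar>A\<bar> * (B * M)) (A + C) (real_conv f g)"
  proof (rule lip_suppI)
    show "0 \<le> 2 * \<bar>A\<bar> * (B * M)" using B M by simp
    fix x y
    have "real_conv f g x - real_conv f g y = (LINT z|lborel. f z * (g (x - z) - g (y - z)))"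
      unfolding real_conv_def Bochner_Integration.integral_diff[OF int int, symmetric]
      by (simp add: algebra_simps)
    also have "norm \<dots> \<le> 2 * \<bar>A\<bar> * (B * (M * \<bar>x - y\<bar>))"
    proof (rule norm_integral_bounded_support)
      fix z
      show "norm (f z * (g (x - z) - g (y - z))) \<le> B * (M * \<bar>x - y\<bar>)"
        unfolding norm_mult using B lip_supp_norm_diff_le[OF g, of "x - z" "y - z"]
        by (intro mult_mono) auto
    next
      fix z assume "\<bar>A\<bar> < \<bar>z\<bar>"
      then have "f z = 0" by (intro lip_supp_eq_0[OF f]) auto
      then show "f z * (g (x - z) - g (y - z)) = 0" by simp
    qed (use B M in auto)
    finally show "norm (real_conv f g x - real_conv f g y) \<le> 2 * \<bar>A\<bar> * (B * M) * \<bar>x - y\<bar>"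
      by (simp add: mult_ac)
  next
    fix x assume x: "A + C < \<bar>x\<bar>"
    have "f y * g (x - y) = 0" for y
    proof (cases "A < \<bar>y\<bar>")
      case True
      then show ?thesis using lip_supp_eq_0[OF f] by simp
    next
      case False
      then have "C < \<bar>x - y\<bar>" using x by linarith
      then show ?thesis using lip_supp_eq_0[OF g] by simp
    qed
    then have "real_conv f g x = (LINT y|(lborel :: real measure). 0)"
      unfolding real_conv_def by presburger
    then show "real_conv f g x = 0" by simp
  qed
  then show ?thesis ..
qed

section \<open>The Fourier transform\<close>

lemma fourier_transform_cis:
  "fourier_transform g \<xi> = (LINT x|lborel. g x * cis (- 2 * pi * x * \<xi>))"
  unfolding fourier_transform_def cis_conv_exp by (simp add: mult_ac)

lemma cis_measurable [measurable (raw)]: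
  "f \<in> borel_measurable M \<Longrightarrow> (\<lambda>x. cis (f x)) \<in> borel_measurable M"
proof -
  have "cis \<in> borel_measurable borel"
    by (intro borel_measurable_continuous_onI continuous_intros)
  then show "f \<in> borel_measurable M \<Longrightarrow> (\<lambda>x. cis (f x)) \<in> borel_measurable M"
    by (rule measurable_compose[rotated])
qed

lemma lborel_integral_shift:
  fixes f :: "real \<Rightarrow> 'a::{banach, second_countable_topology}"
  shows "(LINT x|lborel. f (x + t)) = (LINT x|lborel. f x)"
  using lborel_integral_real_affine[of 1 f t] by (simp add: add.commute)

lemma lborel_integral_reflect:
  fixes f :: "real \<Rightarrow> 'a::{banach, second_countable_topology}"
  shows "(LINT x|lborel. f (- x)) = (LINT x|lborel. f x)"
  using lborel_integral_real_affine[of "-1" f 0] by simp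

lemma fourier_transform_scale:
  assumes "0 < T"
  shows "fourier_transform (\<lambda>x. F (x / T)) \<xi> = T * fourier_transform F (\<xi> * T)"
  unfolding fourier_transform_cis
  using lborel_integral_real_affine[of T "\<lambda>x. F (x / T) * cis (- 2 * pi * x * \<xi>)" 0] assms
  by (simp add: mult_ac scaleR_conv_of_real)

lemma fourier_transform_reflect:
  "fourier_transform (\<lambda>x. F (- x)) \<xi> = fourier_transform F (- \<xi>)"
  unfolding fourier_transform_cis
  using lborel_integral_reflect[of "\<lambda>x. F x * cis (2 * pi * x * \<xi>)"]
  by simp

lemma fourier_transform_cnj:
  "cnj (fourier_transform F \<xi>) = fourier_transform (\<lambda>x. cnj (F x)) (- \<xi>)"
  unfolding fourier_transform_cis Bochner_Integration.integral_cnj[symmetric] by (simp add: cis_cnj)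

text \<open>Conjugation and reflection both send \<xi> to -\<xi>, so the transform of a real even
  function equals its own conjugate.\<close>

lemma fourier_transform_even_real:
  fixes f :: "real \<Rightarrow> real"
  assumes "\<And>x. f (- x) = f x"
  shows "fourier_transform (\<lambda>x. of_real (f x)) \<xi> \<in> \<real>"
  using fourier_transform_cnj[of "\<lambda>x. of_real (f x)" \<xi>]
    fourier_transform_reflect[of "\<lambda>x. of_real (f x)" "\<xi>"]
  by (simp add: assms complex_is_Real_iff complex_eq_iff)

lemma fourier_transform_0:
  "fourier_transform (\<lambda>x. complex_of_real (f x)) 0 = of_real (LINT x|lborel. f x)"
  by (simp add: fourier_transform_cis)

text \<open>The character is multiplicative, so it splits between the two factors before Fubini and
  a translation. Boundedness and bounded support are the form in which the products
  \<open>G t\<close> and \<open>H t\<close> of the positivity proof are estimated.\<close>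

lemma fourier_transform_real_conv:
  assumes f: "f \<in> borel_measurable borel" "\<And>x. \<bar>f x\<bar> \<le> B" "\<And>x. A < \<bar>x\<bar> \<Longrightarrow> f x = 0"
    and g: "g \<in> borel_measurable borel" "\<And>x. \<bar>g x\<bar> \<le> D" "\<And>x. C < \<bar>x\<bar> \<Longrightarrow> g x = 0"
  shows "fourier_transform (\<lambda>x. of_real (real_conv f g x)) \<xi> =
    fourier_transform (\<lambda>x. of_real (f x)) \<xi> * fourier_transform (\<lambda>x. of_real (g x)) \<xi>"
proof -
  note [measurable] = f(1) g(1)
  have B: "0 \<le> B" using f(2)[of 0] by linarith
  define e where "e x = cis (- 2 * pi * x * \<xi>)" for x
  have [measurable]: "e \<in> borel_measurable borel" unfolding e_def by measurable
  have e_add: "e x = e y * e (x - y)" for x y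
    by (simp add: e_def cis_mult algebra_simps)
  define F where "F x = of_real (f x) * e x" for x
  define G where "G x = of_real (g x) * e x" for x
  have [measurable]: "F \<in> borel_measurable borel" "G \<in> borel_measurable borel"
    unfolding F_def G_def by measurable
  have "fourier_transform (\<lambda>x. of_real (real_conv f g x)) \<xi>
      = (LINT x|lborel. LINT y|lborel. of_real (f y * g (x - y)) * e x)"
    unfolding fourier_transform_cis real_conv_def e_def
    by (simp flip: integral_complex_of_real)
  also have "\<dots> = (LINT x|lborel. LINT y|lborel. F y * G (x - y))"
  proof -
    have "of_real (f y * g (x - y)) * e x = F y * G (x - y)" for x y
      using e_add[of x y] by (simp add: F_def G_def)
    then show ?thesis by simp
  qed
  also have "\<dots> = (LINT y|lborel. LINT x|lborel. F y * G (x - y))"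
  proof (rule Fubini_bounded_support[where A = "\<bar>A\<bar> + \<bar>C\<bar>" and B = "B * D"])
    show "norm (F y * G (x - y)) \<le> B * D" for x y
      using f(2)[of y] g(2)[of "x - y"] B
      by (auto simp: F_def G_def e_def norm_mult intro!: mult_mono)
    fix x y :: real assume *: "\<bar>A\<bar> + \<bar>C\<bar> < \<bar>x\<bar> \<or> \<bar>A\<bar> + \<bar>C\<bar> < \<bar>y\<bar>"
    show "F y * G (x - y) = 0"
    proof (cases "A < \<bar>y\<bar>")
      case True
      then show ?thesis using f(3) by (simp add: F_def)
    next
      case False
      then have "C < \<bar>x - y\<bar>" using * by linarith
      then show ?thesis using g(3) by (simp add: G_def)
    qed
  qed measurable
  also have "\<dots> = (LINT y|lborel. F y * (LINT x|lborel. G x))"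
    using lborel_integral_shift[of G "- y" for y] by simp
  also have "\<dots> = (LINT y|lborel. F y) * (LINT x|lborel. G x)"
    by simp
  finally show ?thesis
    unfolding fourier_transform_cis F_def G_def e_def .
qed

section \<open>Fourier series on the unit period\<close>

text \<open>Half-open, so that the integer translates tile the line without overlap; centred, so
  that \<open>0\<close> is interior and |x| is at most 1/2 on it.\<close>

abbreviation unit_period :: "real set" where
  "unit_period \<equiv> {-1/2..<1/2}"

definition fourier_coeff :: "(real \<Rightarrow> complex) \<Rightarrow> int \<Rightarrow> complex" where
  "fourier_coeff G k = (LINT x:unit_period|lborel. G x * cis (- 2 * pi * x * of_int k))"

lemma set_integrable_unit_period:
  fixes G :: "real \<Rightarrow> 'a::{banach, second_countable_topology}"
  assumes [measurable]: "G \<in> borel_measurable borel" and B: "\<And>x. norm (G x) \<le> B"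
  shows "set_integrable lborel unit_period G"
  unfolding set_integrable_def
proof (rule integrable_bounded_support[where r = "1/2" and B = B])
  fix x
  show "norm (indicator unit_period x *\<^sub>R G x) \<le> B"
    using B[of x] norm_ge_zero[of "G x"] by (auto split: split_indicator simp del: norm_ge_zero)
qed (auto split: split_indicator)

lemma cis_orthogonality:
  "(LINT x:unit_period|lborel. cis (2 * pi * x * of_int m)) = (if m = 0 then 1 else 0)"
proof (cases "m = 0")
  case True
  then show ?thesis by (simp add: set_lebesgue_integral_def)
next
  case False
  define F where "F x = cis (2 * pi * x * m) / (2 * pi * m * \<i>)" for x :: real
  have "(LINT x:unit_period|lborel. cis (2 * pi * x * m))
      = (LINT x|lborel. indicator {-1/2..1/2} x *\<^sub>R cis (2 * pi * x * m))"
    unfolding set_lebesgue_integral_def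
    by (intro integral_cong_AE eventually_mono[OF AE_lborel_singleton[of "1/2"]])
      (auto split: split_indicator)
  also have "\<dots> = F (1/2) - F (- 1/2)"
  proof (rule integral_FTC_Icc)
    fix x :: real
    have "((\<lambda>x. cis (2 * pi * x * m)) has_vector_derivative
        (2 * pi * m * \<i>) * cis (2 * pi * x * m)) (at x within {- 1 / 2..1 / 2})"
      unfolding has_vector_derivative_def
      by (rule derivative_eq_intros refl | simp)+ (auto simp: fun_eq_iff scaleR_conv_of_real algebra_simps)
    from has_vector_derivative_divide[OF this, of "2 * pi * m * \<i>"]
    show "(F has_vector_derivative cis (2 * pi * x * m)) (at x within {- 1 / 2..1 / 2})"
      using False by (simp add: F_def[abs_def])
  qed (auto intro!: continuous_intros)
  also have "cis (pi * m) = cis (- pi * m) * cis (2 * pi * m)"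
    unfolding cis_mult by (simp add: algebra_simps)
  then have "F (1/2) - F (- 1/2) = 0"
    by (simp add: F_def)
  finally show ?thesis using False by simp
qed

lemma norm_cis_minus_1: "cmod (cis t - 1) = 2 * \<bar>sin (t / 2)\<bar>"
proof -
  have "(cmod (cis t - 1))\<^sup>2 = (cos t - 1)\<^sup>2 + (sin t)\<^sup>2"
    by (simp add: cmod_power2)
  also have "\<dots> = 2 - 2 * cos t"
    using sin_cos_squared_add[of t] by (simp add: power2_eq_square algebra_simps)
  also have "\<dots> = (2 * \<bar>sin (t / 2)\<bar>)\<^sup>2"
    using cos_double_sin[of "t / 2"] by (simp add: power2_eq_square)
  finally show ?thesis by (rule power2_eq_imp_eq) auto
qed

lemma norm_cis_diff_le: "cmod (cis s - cis t) \<le> \<bar>s - t\<bar>"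
proof -
  have "cis s - cis t = cis t * (cis (s - t) - 1)"
    by (simp add: algebra_simps cis_mult)
  then have "cmod (cis s - cis t) = 2 * \<bar>sin ((s - t) / 2)\<bar>"
    by (simp add: norm_mult norm_cis_minus_1)
  then show ?thesis using abs_sin_x_le_abs_x[of "(s - t) / 2"] by simp
qed

text \<open>Jordan's inequality: \<open>sin\<close> is concave on [0, pi], hence lies above its
  chord from 0 to pi/2.\<close>

lemma sin_pi_ge:
  assumes "0 \<le> x" "x \<le> 1/2"
  shows "2 * x \<le> sin (pi * x)"
proof -
  have "concave_on {0..pi} sin"
  proof (rule f''_le0_imp_concave)
    show "(sin has_real_derivative cos x) (at x)"
      "(cos has_real_derivative - sin x) (at x)" for x :: real
      by (auto intro!: derivative_eq_intros)
    show "- sin x \<le> 0" if "x \<in> {0..pi}" for x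
      using that sin_ge_zero by simp
  qed auto
  from concave_onD[OF this, of "2 * x" 0 "pi / 2"] assms
  show ?thesis by (simp add: mult_ac)
qed

text \<open>Within one period the first character minus one has a zero only at \<open>0\<close>, and
  a simple one. Dividing a Lipschitz increment by it therefore leaves a bounded function, as needed
  in \<open>fourier_series_sums_at_0\<close>.\<close>

lemma norm_cis_minus_1_ge:
  assumes "\<bar>x\<bar> \<le> 1/2"
  shows "4 * \<bar>x\<bar> \<le> cmod (cis (- 2 * pi * x) - 1)"
proof -
  have "2 * \<bar>x\<bar> \<le> sin (pi * \<bar>x\<bar>)" using assms by (intro sin_pi_ge) auto
  then show ?thesis unfolding norm_cis_minus_1 by (cases "0 \<le> x") auto
qed

text \<open>Orthogonality confines the change to the \<open>k\<close>-th coefficient. This removes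
  one harmonic at a time in Bessel's inequality and, with \<open>k = 0\<close>, subtracts the value
  at the origin.\<close>

lemma fourier_coeff_diff_cis:
  assumes G[measurable]: "G \<in> borel_measurable borel" and B: "\<And>x. cmod (G x) \<le> B"
  shows "fourier_coeff (\<lambda>x. G x - d * cis (2 * pi * x * of_int k)) j =
    fourier_coeff G j - (if j = k then d else 0)"
proof -
  have "fourier_coeff (\<lambda>x. G x - d * cis (2 * pi * x * of_int k)) j
    = (LINT x:unit_period|lborel. G x * cis (- 2 * pi * x * of_int j)
        - d * cis (2 * pi * x * of_int (k - j)))"
    unfolding fourier_coeff_def
    by (intro arg_cong[where f = "set_lebesgue_integral lborel unit_period"] ext)
       (simp add: algebra_simps cis_mult)
  also have "\<dots> = fourier_coeff G j - (LINT x:unit_period|lborel. d * cis (2 * pi * x * of_int (k - j)))"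
    unfolding fourier_coeff_def
  proof (rule set_integral_diff)
    show "set_integrable lborel unit_period (\<lambda>x. G x * cis (- 2 * pi * x * of_int j))"
      using B by (intro set_integrable_unit_period[where B = B]) (auto simp: norm_mult)
    show "set_integrable lborel unit_period (\<lambda>x. d * cis (2 * pi * x * of_int (k - j)))"
      by (intro set_integrable_unit_period[where B = "cmod d"]) (auto simp: norm_mult)
  qed
  also have "\<dots> = fourier_coeff G j - (if j = k then d else 0)"
    unfolding set_integral_mult_right cis_orthogonality by auto
  finally show ?thesis .
qed

text \<open>Removing the harmonic \<open>k\<close> lowers the square integral by exactly the square
  of the modulus of its coefficient and leaves the other coefficients alone. The induction therefore
  passes from \<open>G\<close> to a different function \<open>G'\<close>, with a larger
  bound.\<close>

lemma bessel_inequality: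
  assumes "finite S" "G \<in> borel_measurable borel" "\<And>x. cmod (G x) \<le> B"
  shows "(\<Sum>k\<in>S. (cmod (fourier_coeff G k))\<^sup>2) \<le> (LINT x:unit_period|lborel. (cmod (G x))\<^sup>2)"
  using assms
proof (induction S arbitrary: G B rule: finite_induct)
  case empty
  then show ?case
    by (auto simp: set_lebesgue_integral_def intro!: Bochner_Integration.integral_nonneg)
next
  case (insert k S)
  note [measurable] = insert.prems(1)
  note B = insert.prems(2)
  define d where "d = fourier_coeff G k"
  define G' where "G' x = G x - d * cis (2 * pi * x * of_int k)" for x
  have [measurable]: "G' \<in> borel_measurable borel" unfolding G'_def by measurable
  have B': "cmod (G' x) \<le> B + cmod d" for x
    using norm_triangle_ineq4[of "G x" "d * cis (2 * pi * x * of_int k)"] B[of x]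
    by (simp add: G'_def norm_mult)
  have B0: "0 \<le> B" using B[of 0] norm_ge_zero order_trans by blast
  have "(cmod (G' x))\<^sup>2 = (cmod (G x))\<^sup>2 + (cmod d)\<^sup>2
      - 2 * Re (cnj d * (G x * cis (- 2 * pi * x * of_int k)))" for x
  proof -
    have *: "(cmod (a - b))\<^sup>2 = (cmod a)\<^sup>2 + (cmod b)\<^sup>2 - 2 * Re (cnj b * a)" for a b
      unfolding cmod_power2 by (simp add: power2_eq_square algebra_simps)
    show ?thesis unfolding G'_def * by (simp add: norm_mult cis_cnj mult_ac)
  qed
  then have "(LINT x:unit_period|lborel. (cmod (G' x))\<^sup>2)
     = (LINT x:unit_period|lborel. ((cmod (G x))\<^sup>2 + (cmod d)\<^sup>2)
          - Re (2 * cnj d * (G x * cis (- 2 * pi * x * of_int k))))"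
    by (simp add: mult.assoc)
  also have "\<dots> = (LINT x:unit_period|lborel. (cmod (G x))\<^sup>2) + (cmod d)\<^sup>2
      - Re (2 * cnj d * d)"
  proof -
    have 1: "set_integrable lborel unit_period (\<lambda>x. (cmod (G x))\<^sup>2)"
      using B by (intro set_integrable_unit_period[where B = "B\<^sup>2"]) (auto intro!: power_mono)
    have 2: "set_integrable lborel unit_period (\<lambda>x. (cmod d)\<^sup>2)"
      by (intro set_integrable_unit_period[where B = "(cmod d)\<^sup>2"]) auto
    have 3: "set_integrable lborel unit_period (\<lambda>x. G x * cis (- 2 * pi * x * of_int k))"
      using B by (intro set_integrable_unit_period[where B = B]) (auto simp: norm_mult)
    have 4: "set_integrable lborel unit_period (\<lambda>x. 2 * cnj d * (G x * cis (- 2 * pi * x * of_int k)))"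
      using 3 by (rule set_integrable_mult_right)
    have 5: "(LINT x:unit_period|lborel. Re (2 * cnj d * (G x * cis (- 2 * pi * x * of_int k))))
       = Re (LINT x:unit_period|lborel. 2 * cnj d * (G x * cis (- 2 * pi * x * of_int k)))"
      using 4 unfolding set_lebesgue_integral_def set_integrable_def
      by (subst integral_Re[symmetric]) auto
    have 6: "set_integrable lborel unit_period (\<lambda>x. Re (2 * cnj d * (G x * cis (- 2 * pi * x * of_int k))))"
      using integrable_Re[OF 4[unfolded set_integrable_def]] unfolding set_integrable_def by simp
    have 7: "(LINT x:unit_period|lborel. (cmod d)\<^sup>2) = (cmod d)\<^sup>2"
      by (simp add: set_lebesgue_integral_def)
    have 8: "(LINT x:unit_period|lborel. 2 * cnj d * (G x * cis (- 2 * pi * x * of_int k))) = 2 * cnj d * d"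
      unfolding set_integral_mult_right by (simp add: d_def fourier_coeff_def)
    show ?thesis
      unfolding set_integral_diff(2)[OF set_integral_add(1)[OF 1 2] 6]
        set_integral_add(2)[OF 1 2] 5 7 8 ..
  qed
  also have "Re (2 * cnj d * d) = 2 * (cmod d)\<^sup>2"
    unfolding cmod_power2 by (simp add: power2_eq_square algebra_simps)
  finally have eq: "(LINT x:unit_period|lborel. (cmod (G' x))\<^sup>2)
      = (LINT x:unit_period|lborel. (cmod (G x))\<^sup>2) - (cmod d)\<^sup>2" by simp
  have "(\<Sum>j\<in>S. (cmod (fourier_coeff G j))\<^sup>2) = (\<Sum>j\<in>S. (cmod (fourier_coeff G' j))\<^sup>2)"
    using fourier_coeff_diff_cis[OF insert.prems, of d k] insert.hyps
    by (intro sum.cong) (auto simp: G'_def[abs_def])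
  also have "\<dots> \<le> (LINT x:unit_period|lborel. (cmod (G' x))\<^sup>2)"
    by (rule insert.IH[where B = "B + cmod d"]) (use B' in auto)
  finally show ?case using insert.hyps eq by (simp add: d_def)
qed

text \<open>Riemann-Lebesgue via Bessel: the squared moduli have bounded partial sums along any
  injective enumeration \<open>i\<close>, hence tend to \<open>0\<close>. The choice of
  \<open>i\<close> covers both ends of a symmetric range.\<close>

lemma fourier_coeff_tendsto_0:
  assumes G: "G \<in> borel_measurable borel" "\<And>x. cmod (G x) \<le> B" and i: "inj i"
  shows "(\<lambda>n::nat. fourier_coeff G (i n)) \<longlonglongrightarrow> 0"
proof -
  have "summable (\<lambda>n. (cmod (fourier_coeff G (i n)))\<^sup>2)"
  proof (rule summableI_nonneg_bounded)
    fix n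
    have "(\<Sum>m<n. (cmod (fourier_coeff G (i m)))\<^sup>2) = (\<Sum>k\<in>i ` {..<n}. (cmod (fourier_coeff G k))\<^sup>2)"
      using i by (simp add: sum.reindex inj_on_subset)
    also have "\<dots> \<le> (LINT x:unit_period|lborel. (cmod (G x))\<^sup>2)"
      by (rule bessel_inequality[OF _ G]) auto
    finally show "(\<Sum>m<n. (cmod (fourier_coeff G (i m)))\<^sup>2) \<le> (LINT x:unit_period|lborel. (cmod (G x))\<^sup>2)" .
  qed auto
  then have "(\<lambda>n. (cmod (fourier_coeff G (i n)))\<^sup>2) \<longlonglongrightarrow> 0" by (rule summable_LIMSEQ_zero)
  then have "(\<lambda>n. sqrt ((cmod (fourier_coeff G (i n)))\<^sup>2)) \<longlonglongrightarrow> sqrt 0" by (rule tendsto_real_sqrt)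
  then show ?thesis by (simp add: tendsto_norm_zero_iff)
qed

text \<open>Chernoff's argument: dividing by the first character minus one turns the
  partial sums of the Fourier series at \<open>0\<close> into a telescoping sum.\<close>

lemma fourier_series_sums_at_0:
  assumes P: "P \<in> borel_measurable borel" "\<And>x. cmod (P x) \<le> B"
    and lip: "\<And>x. cmod (P x - P 0) \<le> C * \<bar>x\<bar>"
  shows "(\<lambda>N. \<Sum>k\<in>{- int N..int N}. fourier_coeff P k) \<longlonglongrightarrow> P 0"
proof -
  note [measurable] = P(1)
  \<comment> \<open>Division by zero gives \<open>g 0 = 0\<close>, which is harmless:
    \<open>P x - P 0\<close> and the denominator both vanish at \<open>0\<close>, so the product
    identity used below survives. The indicator removes the zeros of the denominator at the other
    integers, so that \<open>g\<close> is bounded on the whole line.\<close>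
  define g where "g x = indicator unit_period x *\<^sub>R ((P x - P 0) / (cis (- 2 * pi * x) - 1))" for x
  have [measurable]: "g \<in> borel_measurable borel" unfolding g_def by measurable
  have C: "0 \<le> C" using lip[of 1] norm_ge_zero[of "P 1 - P 0"] by linarith
  have cis: "4 * \<bar>x\<bar> \<le> cmod (cis (- 2 * pi * x) - 1)" if "x \<in> unit_period" for x
    using that by (intro norm_cis_minus_1_ge) auto
  have g: "cmod (g x) \<le> C / 4" for x
  proof (cases "x \<in> unit_period \<and> x \<noteq> 0")
    case True
    then have "cmod (g x) = cmod (P x - P 0) / cmod (cis (- 2 * pi * x) - 1)"
      by (simp add: g_def norm_divide)
    also have "\<dots> \<le> (C * \<bar>x\<bar>) / (4 * \<bar>x\<bar>)"
      using True cis C lip[of x] by (intro frac_le) auto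
    finally show ?thesis using True by simp
  next
    case False
    then show ?thesis using C by (auto simp: g_def)
  qed
  have telescope: "fourier_coeff P k - (if k = 0 then P 0 else 0)
      = fourier_coeff g (k + 1) - fourier_coeff g k" for k
  proof -
    have "fourier_coeff P k - (if k = 0 then P 0 else 0) = fourier_coeff (\<lambda>x. P x - P 0) k"
      using fourier_coeff_diff_cis[OF P, of "P 0" 0 k] by simp
    also have "\<dots> = (LINT x:unit_period|lborel. g x * cis (- 2 * pi * x * of_int (k + 1))
         - g x * cis (- 2 * pi * x * of_int k))"
      unfolding fourier_coeff_def
    proof (rule set_lebesgue_integral_cong)
      show "\<forall>x. x \<in> unit_period \<longrightarrow> (P x - P 0) * cis (- 2 * pi * x * of_int k) =
        g x * cis (- 2 * pi * x * of_int (k + 1)) - g x * cis (- 2 * pi * x * of_int k)"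
      proof (intro allI impI)
        fix x :: real assume x: "x \<in> unit_period"
        have 1: "P x - P 0 = g x * (cis (- 2 * pi * x) - 1)"
        proof (cases "x = 0")
          case False
          then have "cis (- 2 * pi * x) - 1 \<noteq> 0" using cis[OF x] by auto
          then show ?thesis using x by (simp add: g_def)
        qed simp
        have 2: "cis (- 2 * pi * x * of_int (k + 1))
            = cis (- 2 * pi * x) * cis (- 2 * pi * x * of_int k)"
          by (simp add: cis_mult algebra_simps)
        show "(P x - P 0) * cis (- 2 * pi * x * of_int k) =
          g x * cis (- 2 * pi * x * of_int (k + 1)) - g x * cis (- 2 * pi * x * of_int k)"
          unfolding 1 2 by (simp only: left_diff_distrib right_diff_distrib mult_1_left mult_1_right mult.assoc)
      qed
    qed auto
    also have "\<dots> = fourier_coeff g (k + 1) - fourier_coeff g k"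
      unfolding fourier_coeff_def using g
      by (intro set_integral_diff set_integrable_unit_period[where B = "C / 4"]) (auto simp: norm_mult)
    finally show ?thesis .
  qed
  have sums: "(\<Sum>k\<in>{- int N..int N}. fourier_coeff P k)
      = P 0 + fourier_coeff g (int N + 1) - fourier_coeff g (- int N)" for N
  proof (induction N)
    case 0
    then show ?case using telescope[of 0] by (simp add: algebra_simps)
  next
    case (Suc N)
    have "{- int (Suc N)..int (Suc N)} = insert (- int (Suc N)) (insert (int (Suc N)) {- int N..int N})"
      by auto
    moreover have "fourier_coeff P (int (Suc N))
        = fourier_coeff g (int (Suc N) + 1) - fourier_coeff g (int N + 1)"
      using telescope[of "int (Suc N)"] by (simp add: add.commute)
    moreover have "fourier_coeff P (- int (Suc N))
        = fourier_coeff g (- int N) - fourier_coeff g (- int (Suc N))"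
      using telescope[of "- int (Suc N)"] by simp
    ultimately show ?case using Suc by simp
  qed
  have "(\<lambda>N. P 0 + fourier_coeff g (int N + 1) - fourier_coeff g (- int N)) \<longlonglongrightarrow> P 0 + 0 - 0"
    by (intro tendsto_diff tendsto_add tendsto_const fourier_coeff_tendsto_0[where B = "C / 4"])
       (use g in \<open>auto simp: inj_def\<close>)
  then show ?thesis by (simp add: sums)
qed

section \<open>Periodization and Poisson summation\<close>

text \<open>Each \<open>x\<close> lies in exactly one integer translate of the period, the one with
  \<open>n = \<lfloor>x + 1/2\<rfloor>\<close>.\<close>

lemma sum_indicator_unit_period:
  "(\<Sum>n\<in>{-M..M}. indicator unit_period (x - of_int n))
    = (indicator {- of_int M - 1/2..<of_int M + 1/2} x :: real)"
proof -
  have *: "x - of_int n \<in> unit_period \<longleftrightarrow> n = \<lfloor>x + 1/2\<rfloor>" for n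
    unfolding floor_eq_iff eq_commute[of n] by (auto simp: algebra_simps)
  have "(\<Sum>n\<in>{-M..M}. indicator unit_period (x - of_int n))
      = (\<Sum>n\<in>{-M..M}. if n = \<lfloor>x + 1/2\<rfloor> then 1 else 0 :: real)"
    using * by (intro sum.cong) (auto split: split_indicator)
  also have "\<dots> = (if \<lfloor>x + 1/2\<rfloor> \<in> {-M..M} then 1 else 0)"
    by (simp add: sum.delta')
  also have "\<lfloor>x + 1/2\<rfloor> \<in> {-M..M} \<longleftrightarrow> x \<in> {- of_int M - 1/2..<of_int M + 1/2}"
    by (auto simp: le_floor_iff floor_le_iff)
  finally show ?thesis by (simp add: indicator_def)
qed

text \<open>The unfolding identity, truncated at \<open>M\<close>. It is used in two ways: with
  compact support and \<open>M\<close> so large that nothing is cut off, and with a merely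
  integrable function, where \<open>M\<close> tends to infinity.\<close>

lemma integral_periodize:
  fixes H :: "real \<Rightarrow> 'a::{banach, second_countable_topology}"
  assumes H: "integrable lborel H"
  shows "(LINT x|lborel. indicator {- of_int M - 1/2..<of_int M + 1/2} x *\<^sub>R H x)
    = (LINT x:unit_period|lborel. (\<Sum>n\<in>{-M..M}. H (x + of_int n)))"
proof -
  have shift: "integrable lborel (\<lambda>x. H (x + t))" for t
    using lborel_integrable_real_affine[OF H, of 1 t] by (simp add: add.commute)
  have int: "integrable lborel (\<lambda>x. indicator unit_period (x - t) *\<^sub>R H x)" for t
  proof -
    have "integrable lborel (\<lambda>x. indicator {t - 1/2..<t + 1/2} x *\<^sub>R H x)"
      using H by (intro integrable_mult_indicator) auto
    moreover have "indicator {t - 1/2..<t + 1/2} x = (indicator unit_period (x - t) :: real)" for x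
      by (auto split: split_indicator)
    ultimately show ?thesis by simp
  qed
  have "(LINT x|lborel. indicator {- of_int M - 1/2..<of_int M + 1/2} x *\<^sub>R H x)
     = (LINT x|lborel. (\<Sum>n\<in>{-M..M}. indicator unit_period (x - of_int n) *\<^sub>R H x))"
    by (simp flip: sum_indicator_unit_period add: scaleR_sum_left)
  also have "\<dots> = (\<Sum>n\<in>{-M..M}. (LINT x|lborel. indicator unit_period (x - of_int n) *\<^sub>R H x))"
    by (rule Bochner_Integration.integral_sum) (rule int)
  also have "\<dots> = (\<Sum>n\<in>{-M..M}. (LINT x|lborel. indicator unit_period x *\<^sub>R H (x + of_int n)))"
    using lborel_integral_shift[of "\<lambda>x. indicator unit_period (x - t) *\<^sub>R H x" t for t]
    by simp
  also have "\<dots> = (LINT x|lborel. (\<Sum>n\<in>{-M..M}. indicator unit_period x *\<^sub>R H (x + of_int n)))"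
    using shift by (intro Bochner_Integration.integral_sum[symmetric] integrable_mult_indicator) auto
  finally show ?thesis
    by (simp add: set_lebesgue_integral_def scaleR_sum_right)
qed

text \<open>The window [-M - 1/2, M + 1/2) contains the support, so on the unit period the finite
  sum is the full periodization; \<open>fourier_coeff\<close> sees no other values. Integer
  translations leave the characters unchanged.\<close>

lemma fourier_coeff_periodize:
  assumes F: "lip_supp L A F" and M: "A + 1/2 \<le> of_int M"
  shows "fourier_coeff (\<lambda>x. \<Sum>n\<in>{-M..M}. F (x + of_int n)) k = fourier_transform F (of_int k)"
proof -
  define H where "H x = F x * cis (- 2 * pi * x * of_int k)" for x
  have H0: "H x = 0" if "A < \<bar>x\<bar>" for x
    using lip_supp_eq_0[OF F that] by (simp add: H_def)
  note [measurable] = lip_supp_measurable[OF F]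
  have "H \<in> borel_measurable borel" unfolding H_def by measurable
  moreover obtain B where "\<And>x. cmod (F x) \<le> B" using lip_supp_bounded[OF F] by blast
  ultimately have "integrable lborel H"
    using H0 by (intro integrable_bounded_support[where r = A and B = B]) (auto simp: norm_mult H_def)
  note per = integral_periodize[OF this, of M]
  have sub: "indicator {- of_int M - 1/2..<of_int M + 1/2} x *\<^sub>R H x = H x" for x
    using H0[of x] M by (cases "A < \<bar>x\<bar>") (auto split: split_indicator)
  have shift: "H (x + of_int n) = F (x + of_int n) * cis (- 2 * pi * x * of_int k)" for x n
  proof -
    have "cis (- 2 * pi * (x + of_int n) * of_int k)
        = cis (- 2 * pi * x * of_int k) * cis (2 * pi * (of_int (- n * k)))"
      unfolding cis_mult by (simp add: algebra_simps)
    also have "cis (2 * pi * (of_int (- n * k))) = 1" by (rule cis_multiple_2pi) simp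
    finally show ?thesis by (simp add: H_def)
  qed
  have "fourier_transform F (of_int k) = (LINT x|lborel. H x)"
    by (simp add: fourier_transform_cis H_def)
  also have "\<dots> = fourier_coeff (\<lambda>x. \<Sum>n\<in>{-M..M}. F (x + of_int n)) k"
    unfolding per[unfolded sub] fourier_coeff_def by (simp only: shift sum_distrib_right)
  finally show ?thesis ..
qed

lemma periodize_lipschitz:
  assumes F: "lip_supp L A F"
  shows "norm ((\<Sum>n\<in>{-M..M}. F (x + of_int n)) - (\<Sum>n\<in>{-M..M}. F (of_int n)))
    \<le> real (nat (2 * M + 1)) * L * \<bar>x\<bar>"
proof -
  have "norm ((\<Sum>n\<in>{-M..M}. F (x + of_int n)) - (\<Sum>n\<in>{-M..M}. F (of_int n)))
     \<le> (\<Sum>n\<in>{-M..M}. norm (F (x + of_int n) - F (of_int n)))"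
    unfolding sum_subtractf[symmetric] by (rule norm_sum)
  also have "\<dots> \<le> (\<Sum>n\<in>{-M..M}. L * \<bar>x\<bar>)"
  proof (rule sum_mono)
    show "norm (F (x + of_int n) - F (of_int n)) \<le> L * \<bar>x\<bar>" for n
      using lip_supp_norm_diff_le[OF F, of "x + of_int n" "of_int n"] by simp
  qed
  finally show ?thesis by (simp add: mult.assoc)
qed

lemma poisson_summation:
  assumes F: "lip_supp L A F" and M: "A + 1/2 \<le> of_int M"
  shows "(\<lambda>N. \<Sum>k\<in>{- int N..int N}. fourier_transform F (of_int k)) \<longlonglongrightarrow> (\<Sum>n\<in>{-M..M}. F (of_int n))"
proof -
  define P where "P x = (\<Sum>n\<in>{-M..M}. F (x + of_int n))" for x
  obtain B where B: "\<And>x. cmod (F x) \<le> B" using lip_supp_bounded[OF F] by blast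
  note [measurable] = lip_supp_measurable[OF F]
  have "(\<lambda>N. \<Sum>k\<in>{- int N..int N}. fourier_coeff P k) \<longlonglongrightarrow> P 0"
  proof (rule fourier_series_sums_at_0)
    show "P \<in> borel_measurable borel" unfolding P_def by measurable
    show "cmod (P x) \<le> (\<Sum>n\<in>{-M..M}. B)" for x
      unfolding P_def by (rule sum_norm_le) (rule B)
    show "cmod (P x - P 0) \<le> real (nat (2 * M + 1)) * L * \<bar>x\<bar>" for x
      using periodize_lipschitz[OF F, where M = M and x = x] by (simp add: P_def)
  qed
  then show ?thesis
    using fourier_coeff_periodize[OF F M] by (simp add: P_def[abs_def])
qed

text \<open>The integral of \<open>F\<close> is the mean of its periodization over a period, and the
  lattice sum is the value of the periodization at \<open>0\<close>. The error is thus at most the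
  Lipschitz bound of the periodization: number of terms times \<open>L\<close>. For a function
  dilated by \<open>T\<close> this stays bounded while the integral grows like
  \<open>T\<close>.\<close>

lemma riemann_sum_error:
  assumes F: "lip_supp L A F" and M: "A + 1/2 \<le> of_int M"
  shows "cmod (fourier_transform F 0 - (\<Sum>n\<in>{-M..M}. F (of_int n))) \<le> real (nat (2 * M + 1)) * L"
proof -
  define P where "P x = (\<Sum>n\<in>{-M..M}. F (x + of_int n))" for x
  obtain B where B: "\<And>x. cmod (F x) \<le> B" using lip_supp_bounded[OF F] by blast
  note [measurable] = lip_supp_measurable[OF F]
  have P: "P \<in> borel_measurable borel" unfolding P_def by measurable
  have PB: "cmod (P x) \<le> (\<Sum>n\<in>{-M..M}. B)" for x
    unfolding P_def by (rule sum_norm_le) (rule B)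
  define C where "C = real (nat (2 * M + 1)) * L"
  have C: "0 \<le> C" using lip_supp_nonneg[OF F] by (simp add: C_def)
  have "fourier_transform F 0 - P 0 = fourier_coeff (\<lambda>x. P x - P 0) 0"
    using fourier_coeff_diff_cis[OF P PB, of "P 0" 0 0] fourier_coeff_periodize[OF F M, of 0]
    by (simp add: P_def[abs_def])
  also have "\<dots> = (LINT x|lborel. indicator unit_period x *\<^sub>R (P x - P 0))"
    by (simp add: fourier_coeff_def set_lebesgue_integral_def)
  also have "cmod \<dots> \<le> 2 * (1/2) * C"
  proof (rule norm_integral_bounded_support)
    fix x
    have "cmod (P x - P 0) \<le> C * \<bar>x\<bar>"
      using periodize_lipschitz[OF F, where M = M and x = x] by (simp add: P_def C_def)
    moreover have "C * \<bar>x\<bar> \<le> C * 1" if "x \<in> unit_period"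
      using that C by (intro mult_left_mono) auto
    ultimately show "cmod (indicator unit_period x *\<^sub>R (P x - P 0)) \<le> C"
      using C by (auto split: split_indicator)
  qed (use C in \<open>auto split: split_indicator\<close>)
  finally show ?thesis by (simp add: P_def C_def)
qed

section \<open>Inversion at the origin and positivity\<close>

lemma sum_symmetric_le_limit:
  fixes c :: "int \<Rightarrow> real"
  assumes "\<And>k. 0 \<le> c k" "(\<lambda>N. \<Sum>k\<in>{- int N..int N}. c k) \<longlonglongrightarrow> l"
  shows "(\<Sum>k\<in>{- int N..int N}. c k) \<le> l"
proof (rule incseq_le[OF _ assms(2)])
  show "incseq (\<lambda>N. \<Sum>k\<in>{- int N..int N}. c k)"
    using assms(1) by (intro incseq_SucI sum_mono2) auto
qed

text \<open>Symmetric intervals are cofinal among the finite sets of integers. For non-negative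
  terms \<open>l\<close> thus bounds every finite sum, and the resulting unconditional sum is also
  the limit along these intervals.\<close>

lemma has_sum_symmetric_nonneg:
  fixes c :: "int \<Rightarrow> real"
  assumes c: "\<And>k. 0 \<le> c k" and lim: "(\<lambda>N. \<Sum>k\<in>{- int N..int N}. c k) \<longlonglongrightarrow> l"
  shows "(c has_sum l) UNIV"
proof -
  have subset: "\<exists>N. S \<subseteq> {- int N..int N}" if "finite S" for S :: "int set"
    using that
  proof (induction S rule: finite_induct)
    case (insert k S)
    then obtain N where "S \<subseteq> {- int N..int N}" by blast
    then have "insert k S \<subseteq> {- int (max N (nat \<bar>k\<bar>))..int (max N (nat \<bar>k\<bar>))}"
      by (auto simp: subset_iff)
    then show ?case by blast
  qed simp
  have "c summable_on UNIV"
  proof (rule nonneg_bdd_above_summable_on)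
    show "bdd_above (sum c ` {F. F \<subseteq> UNIV \<and> finite F})"
    proof (rule bdd_aboveI2)
      fix S assume "S \<in> {F::int set. F \<subseteq> UNIV \<and> finite F}"
      then obtain N where "S \<subseteq> {- int N..int N}" using subset by blast
      then have "sum c S \<le> (\<Sum>k\<in>{- int N..int N}. c k)" using c by (intro sum_mono2) auto
      also have "\<dots> \<le> l" by (rule sum_symmetric_le_limit[OF c lim])
      finally show "sum c S \<le> l" .
    qed
  qed (use c in auto)
  then have sum: "(c has_sum infsum c UNIV) UNIV" by simp
  have "filterlim (\<lambda>N. {- int N..int N}) (finite_subsets_at_top UNIV) sequentially"
    unfolding filterlim_finite_subsets_at_top
  proof (intro allI impI)
    fix X :: "int set" assume "finite X \<and> X \<subseteq> UNIV"
    then obtain N where "X \<subseteq> {- int N..int N}" using subset by blast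
    then show "\<forall>\<^sub>F n in sequentially. finite {- int n..int n} \<and> X \<subseteq> {- int n..int n} \<and> {- int n..int n} \<subseteq> UNIV"
      by (intro eventually_sequentiallyI[of N]) auto
  qed
  from filterlim_compose[OF sum[unfolded has_sum_def] this]
  have "(\<lambda>N. \<Sum>k\<in>{- int N..int N}. c k) \<longlonglongrightarrow> infsum c UNIV" .
  then show ?thesis using sum LIMSEQ_unique[OF lim] by simp
qed

lemma infsum_int_even:
  fixes v :: "int \<Rightarrow> 'a::{banach, real_normed_algebra_1}"
  assumes v: "v summable_on UNIV" and even: "\<And>k. v (- k) = v k"
  shows "infsum v UNIV = v 0 + 2 * (\<Sum>\<^sub>\<infinity>k\<in>{1::nat..}. v (int k))"
proof -
  have s: "v summable_on S" for S using v by (rule summable_on_subset_banach) auto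
  have pos: "infsum v {1..} = (\<Sum>\<^sub>\<infinity>k\<in>{1::nat..}. v (int k))"
  proof -
    have "x \<in> int ` {1..}" if "1 \<le> x" for x
      using that by (intro image_eqI[of _ _ "nat x"]) auto
    then have "{1..} = int ` {1..}" by auto
    then show ?thesis by (simp add: infsum_reindex o_def)
  qed
  have neg: "infsum v {..-1} = infsum v {1..}"
  proof -
    have "{..-1} = uminus ` {1::int..}" by simp
    then have "infsum v {..-1} = infsum (v \<circ> uminus) {1..}"
      by (simp only:) (rule infsum_reindex, simp)
    then show ?thesis by (simp add: o_def even)
  qed
  have "(UNIV :: int set) = ({..-1} \<union> {0}) \<union> {1..}" by auto
  then have "infsum v UNIV = infsum v (({..-1} \<union> {0}) \<union> {1..})" by simp
  also have "\<dots> = infsum v {..-1} + v 0 + infsum v {1..}"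
    by (subst infsum_Un_disjoint, (auto intro: s)[3], subst infsum_Un_disjoint) (auto intro: s)
  finally show ?thesis unfolding neg pos by (simp add: algebra_simps mult_2)
qed

text \<open>Poisson summation for \<open>w\<close> modulated by \<theta> says that the sum of
  u(\<theta> + k) over all integers k is the trigonometric polynomial \<open>W \<theta>\<close> with
  coefficients \<open>w n\<close>. Integrated over a period, \<open>W\<close> leaves only its
  constant term \<open>w 0\<close>, and the sum unfolds to the integral of \<open>u\<close> over the
  line.\<close>

lemma fourier_inversion_at_0:
  fixes w u :: "real \<Rightarrow> real"
  assumes w: "lip_supp L A w" and wu: "\<And>\<xi>. fourier_transform (\<lambda>x. of_real (w x)) \<xi> = of_real (u \<xi>)"
    and u: "\<And>\<xi>. 0 \<le> u \<xi>" "integrable lborel u"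
  shows "w 0 = (LINT \<xi>|lborel. u \<xi>)"
proof -
  \<comment> \<open>Taking \<open>M\<close> from a natural number keeps \<open>n = 0\<close> in the
    range even if \<open>A\<close> is negative; that term is the one that survives the
    averaging.\<close>
  obtain m where m: "A + 1/2 \<le> real m" using real_arch_simple by blast
  define M where "M = int m"
  have M: "A + 1/2 \<le> of_int M" "0 \<le> M" using m by (auto simp: M_def)
  define W where "W \<theta> = (\<Sum>n\<in>{-M..M}. of_real (w (of_int n)) * cis (2 * pi * \<theta> * of_int (- n)))" for \<theta>
  define S where "S N \<theta> = (\<Sum>k\<in>{- int N..int N}. u (\<theta> + of_int k))" for N \<theta>
  define C where "C = (\<Sum>n\<in>{-M..M}. \<bar>w (of_int n)\<bar>)"
  have [measurable]: "u \<in> borel_measurable borel"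
    using borel_measurable_integrable[OF u(2)] by simp
  have lim: "(\<lambda>N. of_real (S N \<theta>)) \<longlonglongrightarrow> W \<theta>" for \<theta>
  proof -
    define F where "F x = of_real (w x) * cis (2 * pi * \<theta> * (- x))" for x
    have "(2 * pi * \<bar>\<theta>\<bar>)-lipschitz_on UNIV (\<lambda>x. cis (2 * pi * \<theta> * (- x)))"
    proof (rule lipschitz_onI)
      fix x y :: real
      have "dist (cis (2 * pi * \<theta> * (- x))) (cis (2 * pi * \<theta> * (- y)))
          \<le> \<bar>2 * pi * \<theta> * (- x) - 2 * pi * \<theta> * (- y)\<bar>"
        unfolding dist_norm by (rule norm_cis_diff_le)
      also have "\<dots> = \<bar>(2 * pi * \<theta>) * (y - x)\<bar>" by (simp add: algebra_simps)
      also have "\<dots> = 2 * pi * \<bar>\<theta>\<bar> * dist x y"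
        by (simp add: abs_mult dist_real_def abs_minus_commute)
      finally show "dist (cis (2 * pi * \<theta> * (- x))) (cis (2 * pi * \<theta> * (- y)))
          \<le> 2 * pi * \<bar>\<theta>\<bar> * dist x y" .
    qed simp
    then obtain L' where F: "lip_supp L' A F"
      using lip_supp_mult[OF lip_supp_of_real[OF w], of _ "\<lambda>x. cis (2 * pi * \<theta> * (- x))" 1]
      by (auto simp: F_def[abs_def])
    have "fourier_transform F (of_int k) = of_real (u (\<theta> + of_int k))" for k
      unfolding wu[symmetric] fourier_transform_cis F_def
      by (simp add: cis_mult mult.assoc algebra_simps)
    with poisson_summation[OF F M(1)] show ?thesis
      by (simp add: S_def W_def F_def)
  qed
  \<comment> \<open>Since \<open>u\<close> is non-negative, the partial sums lie below their limit.
    This gives a bound uniform in \<open>N\<close> and \<theta>, as dominated convergence over the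
    period requires.\<close>
  have S: "0 \<le> S N \<theta>" "S N \<theta> \<le> C" for N \<theta>
  proof -
    show "0 \<le> S N \<theta>" unfolding S_def by (intro sum_nonneg u)
    have "S N \<theta> \<le> Re (W \<theta>)"
      using tendsto_Re[OF lim[of \<theta>]] u(1) unfolding S_def
      by (intro sum_symmetric_le_limit) simp_all
    also have "\<dots> \<le> cmod (W \<theta>)" by (rule complex_Re_le_cmod)
    also have "\<dots> \<le> C"
      unfolding W_def C_def by (rule sum_norm_le) (simp add: norm_mult)
    finally show "S N \<theta> \<le> C" .
  qed
  have lim1: "(\<lambda>N. LINT \<theta>|lborel. indicator unit_period \<theta> *\<^sub>R complex_of_real (S N \<theta>))
      \<longlonglongrightarrow> (LINT \<theta>|lborel. indicator unit_period \<theta> *\<^sub>R W \<theta>)"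
  proof (rule integral_dominated_convergence[where w = "\<lambda>\<theta>. indicator unit_period \<theta> * C"])
    show "integrable lborel (\<lambda>\<theta>. indicator unit_period \<theta> * C)"
      by (intro integrable_mult_left integrable_real_indicator) auto
    show "AE \<theta> in lborel. (\<lambda>N. indicator unit_period \<theta> *\<^sub>R complex_of_real (S N \<theta>))
        \<longlonglongrightarrow> indicator unit_period \<theta> *\<^sub>R W \<theta>"
      by (intro AE_I2 tendsto_scaleR tendsto_const lim)
    show "AE \<theta> in lborel. norm (indicator unit_period \<theta> *\<^sub>R complex_of_real (S N \<theta>))
        \<le> indicator unit_period \<theta> * C" for N
      using S by (intro AE_I2) (auto split: split_indicator)
  qed (auto simp: W_def S_def)
  have lim1_eq: "(LINT \<theta>|lborel. indicator unit_period \<theta> *\<^sub>R W \<theta>) = of_real (w 0)"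
  proof -
    have "(LINT \<theta>|lborel. indicator unit_period \<theta> *\<^sub>R W \<theta>)
      = (LINT \<theta>|lborel. (\<Sum>n\<in>{-M..M}. of_real (w (of_int n)) *
           (indicator unit_period \<theta> *\<^sub>R cis (2 * pi * \<theta> * of_int (- n)))))"
      unfolding W_def scaleR_sum_right by (intro Bochner_Integration.integral_cong sum.cong) auto
    also have "\<dots> = (\<Sum>n\<in>{-M..M}. (LINT \<theta>|lborel. of_real (w (of_int n)) *
           (indicator unit_period \<theta> *\<^sub>R cis (2 * pi * \<theta> * of_int (- n)))))"
    proof (rule Bochner_Integration.integral_sum)
      fix n
      have "set_integrable lborel unit_period (\<lambda>\<theta>. cis (2 * pi * \<theta> * of_int (- n)))"
        by (rule set_integrable_unit_period[where B = 1]) auto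
      then show "integrable lborel (\<lambda>\<theta>. complex_of_real (w (of_int n)) *
           (indicator unit_period \<theta> *\<^sub>R cis (2 * pi * \<theta> * of_int (- n))))"
        unfolding set_integrable_def by (rule integrable_mult_right)
    qed
    also have "\<dots> = (\<Sum>n\<in>{-M..M}. of_real (w (of_int n)) * (if n = 0 then 1 else 0))"
      using cis_orthogonality[of "- n" for n]
      by (simp only: integral_mult_right_zero set_lebesgue_integral_def neg_equal_0_iff_equal)
    also have "\<dots> = (\<Sum>n\<in>{-M..M}. if n = 0 then of_real (w (of_int n)) else 0)"
      by (intro sum.cong) auto
    also have "\<dots> = of_real (w 0)" using M by (simp add: sum.delta)
    finally show ?thesis .
  qed
  have unfold: "(LINT \<theta>|lborel. indicator unit_period \<theta> *\<^sub>R complex_of_real (S N \<theta>))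
      = (LINT x|lborel. indicator {- real N - 1/2..<real N + 1/2} x *\<^sub>R complex_of_real (u x))" for N
    using integral_periodize[of "\<lambda>x. complex_of_real (u x)" "int N"] u(2)
    by (simp add: set_lebesgue_integral_def S_def)
  \<comment> \<open>The unfolded integrals run over intervals that exhaust the line, dominated by
    \<open>u\<close> itself; here the integrability of \<open>u\<close> is used.\<close>
  have lim2: "(\<lambda>N. LINT x|lborel. indicator {- real N - 1/2..<real N + 1/2} x *\<^sub>R complex_of_real (u x))
      \<longlonglongrightarrow> (LINT x|lborel. complex_of_real (u x))"
  proof (rule integral_dominated_convergence[where w = u])
    show "AE x in lborel. (\<lambda>N. indicator {- real N - 1/2..<real N + 1/2} x *\<^sub>R complex_of_real (u x))
        \<longlonglongrightarrow> complex_of_real (u x)"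
    proof (rule AE_I2)
      fix x
      obtain n where n: "\<bar>x\<bar> \<le> real n" using real_arch_simple by blast
      show "(\<lambda>N. indicator {- real N - 1/2..<real N + 1/2} x *\<^sub>R complex_of_real (u x))
        \<longlonglongrightarrow> complex_of_real (u x)"
        by (rule tendsto_eventually, rule eventually_sequentiallyI[of n])
           (use n in \<open>auto split: split_indicator\<close>)
    qed
    show "AE x in lborel. norm (indicator {- real N - 1/2..<real N + 1/2} x *\<^sub>R complex_of_real (u x))
        \<le> u x" for N
      using u(1) by (intro AE_I2) (auto split: split_indicator)
  qed (use u in auto)
  have "complex_of_real (w 0) = (LINT x|lborel. complex_of_real (u x))"
    by (rule LIMSEQ_unique[OF lim1[unfolded lim1_eq unfold] lim2])
  then show ?thesis by (simp only: integral_complex_of_real of_real_eq_iff)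
qed

text \<open>With \<open>G t y = K y * K (y + t)\<close>, the square of the autocorrelation of \<open>K\<close> is the integral
  over \<open>t\<close> of the autocorrelations of \<open>G t\<close>, so that its transform is an integral of the
  squares of the absolute values of the transforms of \<open>G t\<close>.\<close>

lemma fourier_transform_square_conv_nonneg:
  fixes K :: "real \<Rightarrow> real"
  assumes K: "lip_supp L A K" and even: "\<And>x. K (- x) = K x" and A: "0 \<le> A"
  shows "fourier_transform (\<lambda>x. of_real ((real_conv K K x)\<^sup>2)) \<xi> \<in> \<real>\<^sub>\<ge>\<^sub>0"
proof -
  obtain B where B: "0 \<le> B" "\<And>x. norm (K x) \<le> B" using lip_supp_bounded[OF K] by blast
  note [measurable] = lip_supp_measurable[OF K]
  note K0 = lip_supp_eq_0[OF K]
  define G where "G t y = K y * K (y + t)" for t y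
  define H where "H t z = K z * K (z - t)" for t z
  have GB: "\<bar>G t y\<bar> \<le> B * B" and HB: "\<bar>H t y\<bar> \<le> B * B" for t y
    using B unfolding G_def H_def abs_mult by (auto intro!: mult_mono)
  have G0: "G t y = 0" and H0: "H t y = 0" if "A < \<bar>y\<bar>" for t y
    using K0[OF that] by (auto simp: G_def H_def)
  have [measurable]: "G t \<in> borel_measurable borel" "H t \<in> borel_measurable borel" for t
    unfolding G_def H_def by measurable
  have sq: "(real_conv K K x)\<^sup>2 = (LINT t|lborel. real_conv (G t) (H t) x)" for x
  proof -
    have "(real_conv K K x)\<^sup>2 = (LINT y|lborel. K y * K (x - y) * real_conv K K x)"
      by (simp add: real_conv_def power2_eq_square)
    \<comment> \<open>The variable of the second convolution is written \<open>t + y\<close>. The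
      four factors then regroup into a function of \<open>y\<close> and a function of
      \<open>x - y\<close> for each fixed \<open>t\<close>.\<close>
    also have "\<dots> = (LINT y|lborel. LINT t|lborel. K y * K (x - y) * (K (t + y) * K (x - (t + y))))"
      using lborel_integral_shift[of "\<lambda>t. K t * K (x - t)"] by (simp add: real_conv_def)
    also have "\<dots> = (LINT y|lborel. LINT t|lborel. G t y * H t (x - y))"
      by (simp add: G_def H_def algebra_simps)
    also have "\<dots> = (LINT t|lborel. LINT y|lborel. G t y * H t (x - y))"
    proof (rule Fubini_bounded_support[where A = "2 * A" and B = "(B * B) * (B * B)"])
      show "norm (G t y * H t (x - y)) \<le> (B * B) * (B * B)" for t y
        using GB HB B unfolding real_norm_def abs_mult by (intro mult_mono) auto
      fix y t :: real assume *: "2 * A < \<bar>y\<bar> \<or> 2 * A < \<bar>t\<bar>"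
      show "G t y * H t (x - y) = 0"
      proof (cases "A < \<bar>y\<bar>")
        case False
        then have "A < \<bar>y + t\<bar>" using * A by linarith
        then show ?thesis using K0 by (simp add: G_def)
      qed (simp add: G0)
    qed (unfold G_def H_def, measurable)
    finally show ?thesis by (simp add: real_conv_def)
  qed
  have "fourier_transform (\<lambda>x. of_real ((real_conv K K x)\<^sup>2)) \<xi>
    = (LINT x|lborel. LINT t|lborel. of_real (real_conv (G t) (H t) x) * cis (- 2 * pi * x * \<xi>))"
    unfolding fourier_transform_cis sq by (simp flip: integral_complex_of_real)
  also have "\<dots> = (LINT t|lborel. LINT x|lborel. of_real (real_conv (G t) (H t) x) * cis (- 2 * pi * x * \<xi>))"
  proof (rule Fubini_bounded_support[where A = "2 * A" and B = "2 * A * ((B * B) * (B * B))"])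
    fix x t :: real
    have "\<bar>real_conv (G t) (H t) x\<bar> \<le> 2 * A * ((B * B) * (B * B))"
      unfolding real_conv_def real_norm_def[symmetric]
    proof (rule norm_integral_bounded_support)
      show "norm (G t y * H t (x - y)) \<le> (B * B) * (B * B)" for y
        using GB HB B unfolding real_norm_def abs_mult by (intro mult_mono) auto
    qed (use G0 A B in auto)
    then show "norm (of_real (real_conv (G t) (H t) x) * cis (- 2 * pi * x * \<xi>)) \<le> 2 * A * ((B * B) * (B * B))"
      by (simp add: norm_mult)
  next
    fix x t :: real assume *: "2 * A < \<bar>x\<bar> \<or> 2 * A < \<bar>t\<bar>"
    have "G t y * H t (x - y) = 0" for y
    proof -
      have "A < \<bar>y\<bar> \<or> A < \<bar>y + t\<bar> \<or> A < \<bar>x - y\<bar>" using * by linarith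
      then show ?thesis using K0 by (auto simp: G_def H_def)
    qed
    then have "real_conv (G t) (H t) x = (LINT y|(lborel :: real measure). 0)"
      unfolding real_conv_def by presburger
    then show "of_real (real_conv (G t) (H t) x) * cis (- 2 * pi * x * \<xi>) = 0" by simp
  qed (unfold G_def H_def real_conv_def, measurable)
  also have "\<dots> = (LINT t|lborel. complex_of_real ((cmod (fourier_transform (\<lambda>x. of_real (G t x)) \<xi>))\<^sup>2))"
  proof (rule Bochner_Integration.integral_cong)
    fix t
    \<comment> \<open>Evenness of \<open>K\<close> makes \<open>H t\<close> the reflection of
      \<open>G t\<close>, so the two transforms are conjugate and their product is a squared
      modulus.\<close>
    have "(\<lambda>x. H t x) = (\<lambda>x. G t (- x))"
    proof
      show "H t x = G t (- x)" for x
        using even[of x] even[of "x - t"] by (simp add: G_def H_def)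
    qed
    then have "fourier_transform (\<lambda>x. of_real (H t x)) \<xi> = cnj (fourier_transform (\<lambda>x. of_real (G t x)) \<xi>)"
      using fourier_transform_reflect[of "\<lambda>x. complex_of_real (G t x)" \<xi>]
        fourier_transform_cnj[of "\<lambda>x. complex_of_real (G t x)" \<xi>] by simp
    moreover have "(LINT x|lborel. of_real (real_conv (G t) (H t) x) * cis (- 2 * pi * x * \<xi>))
      = fourier_transform (\<lambda>x. of_real (G t x)) \<xi> * fourier_transform (\<lambda>x. of_real (H t x)) \<xi>"
      unfolding fourier_transform_cis[symmetric]
      by (rule fourier_transform_real_conv[where A = A and C = A and B = "B * B" and D = "B * B"])
         (use GB HB G0 H0 in auto)
    ultimately show "(LINT x|lborel. of_real (real_conv (G t) (H t) x) * cis (- 2 * pi * x * \<xi>))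
      = complex_of_real ((cmod (fourier_transform (\<lambda>x. of_real (G t x)) \<xi>))\<^sup>2)"
      by (simp add: complex_norm_square del: of_real_power)
  qed simp
  also have "\<dots> \<in> \<real>\<^sub>\<ge>\<^sub>0"
    unfolding integral_complex_of_real nonneg_Reals_of_real_iff
    by (rule Bochner_Integration.integral_nonneg) simp
  finally show ?thesis .
qed

section \<open>Reduction to a lattice sum\<close>

text \<open>Up to sign, \<open>min (real r) (real q - real r)\<close> is the representative of r
  modulo q nearest to \<open>0\<close>. Integers that are not such representatives have modulus at
  least q/2, which exceeds A q h because A h < 1/2; there \<open>g\<close> vanishes. For \<kappa>^2,
  where A = 2, this is the condition h < 1/4.\<close>

lemma sum_fold_residues:
  fixes g :: "real \<Rightarrow> 'a::comm_monoid_add"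
  assumes even: "\<And>x. g (- x) = g x" and supp: "\<And>x. A < \<bar>x\<bar> \<Longrightarrow> g x = 0"
    and h: "0 < h" "A * h < 1/2" and q: "1 \<le> q" and M: "A * (real q * h) \<le> of_int M"
  shows "(\<Sum>r<q. g (min (real r) (real q - real r) / (real q * h)))
    = (\<Sum>n\<in>{-M..M}. g (of_int n / (real q * h)))"
proof -
  define T where "T = real q * h"
  have T: "0 < T" using h q by (simp add: T_def)
  \<comment> \<open>The tie \<open>2 * r = q\<close> goes to -q/2; the point q/2 left out is beyond
    the support, as is -q/2.\<close>
  define i where "i r = (if 2 * r < q then int r else int r - int q)" for r :: nat
  have inj: "inj_on i {..<q}" by (auto simp: inj_on_def i_def split: if_splits)
  have outside: "g (of_int n / T) = 0" if "A * T < \<bar>of_int n\<bar>" for n :: int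
  proof (rule supp)
    show "A < \<bar>of_int n / T\<bar>" using that T by (simp add: field_simps)
  qed
  have "(\<Sum>r<q. g (min (real r) (real q - real r) / T)) = (\<Sum>r<q. g (of_int (i r) / T))"
  proof (rule sum.cong)
    fix r
    show "g (min (real r) (real q - real r) / T) = g (of_int (i r) / T)"
    proof (cases "2 * r < q")
      case True
      then have "min (real r) (real q - real r) = of_int (i r)" by (simp add: i_def)
      then show ?thesis by simp
    next
      case False
      then have "min (real r) (real q - real r) = - of_int (i r)"
        by (auto simp: i_def min_def)
      then show ?thesis using even[of "of_int (i r) / T"] by simp
    qed
  qed simp
  also have "\<dots> = (\<Sum>n\<in>i ` {..<q}. g (of_int n / T))"
    using inj by (simp add: sum.reindex)
  also have "\<dots> = (\<Sum>n\<in>{-M..M}. g (of_int n / T))"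
  proof (rule sum.mono_neutral_cong)
    fix n assume "n \<in> {-M..M} - i ` {..<q}"
    then have n: "n \<notin> i ` {..<q}" by simp
    have "int q \<le> 2 * \<bar>n\<bar>"
    proof (rule ccontr)
      assume *: "\<not> int q \<le> 2 * \<bar>n\<bar>"
      have "n = i (nat (if 0 \<le> n then n else n + int q))"
        using * by (auto simp: i_def)
      moreover have "nat (if 0 \<le> n then n else n + int q) \<in> {..<q}" using * by auto
      ultimately show False using n by blast
    qed
    then have "real_of_int (int q) \<le> of_int (2 * \<bar>n\<bar>)" by (simp only: of_int_le_iff)
    then have "real q \<le> 2 * \<bar>of_int n\<bar>" by simp
    moreover have "2 * (A * T) < real q"
    proof -
      have "real q * (A * h) < real q * (1/2)" using h q by (intro mult_strict_left_mono) auto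
      then show ?thesis by (simp add: T_def mult_ac)
    qed
    ultimately show "g (of_int n / T) = 0" by (intro outside) linarith
  next
    fix n assume "n \<in> i ` {..<q} - {-M..M}"
    then have "M < \<bar>n\<bar>" by auto
    then have "of_int M < \<bar>real_of_int n\<bar>" by linarith
    then show "g (of_int n / T) = 0" using M by (intro outside) (simp add: T_def)
  qed auto
  finally show ?thesis by (simp add: T_def)
qed

text \<open>A non-zero integral rules out a function vanishing almost everywhere. Applied to
  \<open>K\<close> and to \<open>kap K\<close>, it makes \<open>RK K\<close> and
  \<open>kap_norm_sq K\<close> positive, as the quotients require.\<close>

lemma lip_supp_integral_square_pos:
  fixes f :: "real \<Rightarrow> real"
  assumes f: "lip_supp L A f" and nz: "(LINT x|lborel. f x) \<noteq> 0"
  shows "0 < (LINT x|lborel. (f x)\<^sup>2)"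
proof -
  obtain L' where "lip_supp L' A (\<lambda>x. (f x)\<^sup>2)" using lip_supp_power2[OF f] by blast
  then have int: "integrable lborel (\<lambda>x. (f x)\<^sup>2)" by (rule lip_supp_integrable)
  have "(LINT x|lborel. (f x)\<^sup>2) \<noteq> 0"
  proof
    assume "(LINT x|lborel. (f x)\<^sup>2) = 0"
    then have "AE x in lborel. (f x)\<^sup>2 = 0"
      using integral_nonneg_eq_0_iff_AE[OF int] by simp
    then have "AE x in lborel. f x = 0" by simp
    then have "(LINT x|lborel. f x) = 0" by (rule integral_eq_zero_AE)
    with nz show False by simp
  qed
  moreover have "0 \<le> (LINT x|lborel. (f x)\<^sup>2)" by (rule Bochner_Integration.integral_nonneg) simp
  ultimately show ?thesis by linarith
qed

lemma real_conv_even: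
  assumes "\<And>x. f (- x) = f x" "\<And>x. g (- x) = g x"
  shows "real_conv f g (- x) = real_conv f g x"
proof -
  have "real_conv f g (- x) = (LINT y|lborel. f (- y) * g (- x - (- y)))"
    unfolding real_conv_def by (rule lborel_integral_reflect[symmetric])
  also have "\<dots> = real_conv f g x"
    unfolding real_conv_def
  proof (rule Bochner_Integration.integral_cong)
    show "f (- y) * g (- x - (- y)) = f y * g (x - y)" for y
      using assms(1)[of y] assms(2)[of "x - y"] by simp
  qed simp
  finally show ?thesis .
qed

lemma lip_supp_fourier_transform_real_conv:
  fixes f g :: "real \<Rightarrow> real"
  assumes f: "lip_supp L A f" and g: "lip_supp M C g"
  shows "fourier_transform (\<lambda>x. of_real (real_conv f g x)) \<xi> =
    fourier_transform (\<lambda>x. of_real (f x)) \<xi> * fourier_transform (\<lambda>x. of_real (g x)) \<xi>"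
proof -
  obtain B where B: "\<And>x. norm (f x) \<le> B" using lip_supp_bounded[OF f] by blast
  obtain D where D: "\<And>x. norm (g x) \<le> D" using lip_supp_bounded[OF g] by blast
  show ?thesis
    using B D lip_supp_eq_0[OF f] lip_supp_eq_0[OF g]
    by (intro fourier_transform_real_conv[where A = A and C = C and B = B and D = D]
         lip_supp_measurable[OF f] lip_supp_measurable[OF g]) auto
qed

section \<open>Assembly: Plancherel, the dual series, the two bounds and their sharpness\<close>

theorem lemma3p3:
  fixes K :: "real \<Rightarrow> real"
  assumes symmetric: "\<And>x. K (- x) = K x"
    and lipschitz: "\<exists>L. L-lipschitz_on UNIV K"
    and support: "\<And>x. x \<notin> {-1..1} \<Longrightarrow> K x = 0"
    and integral_one: "(LINT x|lborel. K x) = 1"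
    and L4: "integrable lborel (\<lambda>\<xi>. (cmod (K_hat K \<xi>)) ^ 4)"
  shows
    "RK K = kap K 0 \<and>
     kap_norm_sq K = (LINT \<xi>|lborel. (cmod (K_hat K \<xi>)) ^ 4) \<and>
     c_const K = (LINT x|lborel. (K x)\<^sup>2)\<^sup>2 / (LINT \<xi>|lborel. (cmod (K_hat K \<xi>)) ^ 4) \<and>
     (\<forall>(q::nat) (h::real). 1 \<le> q \<longrightarrow> 0 < h \<longrightarrow> h < 1 / 4 \<longrightarrow>
        (\<lambda>k::int. kap_sq_hat K (real_of_int k * real q * h)) summable_on UNIV \<and>
        complex_of_real (Sigma_q K q h) =
          complex_of_real h * (\<Sum>\<^sub>\<infinity>k::int. kap_sq_hat K (real_of_int k * real q * h)) \<and>
        complex_of_real (Sigma_q K q h) =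
          complex_of_real (h * kap_norm_sq K) +
          2 * complex_of_real h * (\<Sum>\<^sub>\<infinity>k\<in>{1::nat..}. kap_sq_hat K (real k * real q * h)) \<and>
        (\<forall>k::int. kap_sq_hat K (real_of_int k * real q * h) \<in> \<real>\<^sub>\<ge>\<^sub>0) \<and>
        r_q K q h \<le> min (real q) (c_const K / h) \<and>
        (real q * h < 1 / 2 \<longrightarrow> r_q K q h = real q)) \<and>
     ((\<lambda>(q, h). r_q K q h * h) \<longlongrightarrow> c_const K) qh_at_top"
proof -
  obtain L where "L-lipschitz_on UNIV K" using lipschitz by blast
  then have K: "lip_supp L 1 K" by (auto simp: lip_supp_def intro!: support)
  obtain L2 where kap: "lip_supp L2 2 (kap K)"
    using lip_supp_real_conv[OF K K] by (auto simp: kap_def)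
  obtain L3 where kap2: "lip_supp L3 2 (\<lambda>x. (kap K x)\<^sup>2)"
    using lip_supp_power2[OF kap] by blast
  have kap_even: "kap K (- x) = kap K x" for x
    unfolding kap_def by (rule real_conv_even) (rule symmetric)+
  have RK_kap: "RK K = kap K 0"
    by (simp add: RK_def kap_def real_conv_def symmetric power2_eq_square)
  have RK_pos: "0 < RK K"
    unfolding RK_def by (rule lip_supp_integral_square_pos[OF K]) (simp add: integral_one)
  have kap_hat: "fourier_transform (\<lambda>x. of_real (kap K x)) \<xi> = K_hat K \<xi> * K_hat K \<xi>" for \<xi>
    unfolding kap_def K_hat_def by (rule lip_supp_fourier_transform_real_conv[OF K K])
  have norm_pos: "0 < kap_norm_sq K"
    unfolding kap_norm_sq_def
  proof (rule lip_supp_integral_square_pos[OF kap])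
    \<comment> \<open>At frequency \<open>0\<close> the convolution theorem reads: the integral of
      \<kappa> is the square of the integral of \<open>K\<close>, that is 1.\<close>
    show "(LINT x|lborel. kap K x) \<noteq> 0"
      using kap_hat[of 0] unfolding K_hat_def fourier_transform_0 integral_one
      by auto
  qed

  have plancherel: "kap_norm_sq K = (LINT \<xi>|lborel. (cmod (K_hat K \<xi>)) ^ 4)"
  proof -
    \<comment> \<open>Inversion is applied to \<kappa> convolved with itself. Its value at
      \<open>0\<close> is the integral of \<kappa>^2 because \<kappa> is even, and its transform is
      the fourth power of \<open>K_hat K\<close>, which is non-negative because
      \<open>K_hat K\<close> is real.\<close>
    obtain L4 where w: "lip_supp L4 (2 + 2) (real_conv (kap K) (kap K))"
      using lip_supp_real_conv[OF kap kap] by blast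
    have "kap_norm_sq K = real_conv (kap K) (kap K) 0"
      by (simp add: kap_norm_sq_def real_conv_def kap_even power2_eq_square)
    also have "\<dots> = (LINT \<xi>|lborel. (cmod (K_hat K \<xi>)) ^ 4)"
    proof (rule fourier_inversion_at_0[OF w])
      fix \<xi>
      have "K_hat K \<xi> \<in> \<real>"
        unfolding K_hat_def by (rule fourier_transform_even_real) (rule symmetric)
      then obtain r where r: "K_hat K \<xi> = of_real r" by (auto elim: Reals_cases)
      show "fourier_transform (\<lambda>x. of_real (real_conv (kap K) (kap K) x)) \<xi> = of_real ((cmod (K_hat K \<xi>)) ^ 4)"
        unfolding lip_supp_fourier_transform_real_conv[OF kap kap] kap_hat r
        by (simp add: power4_eq_xxxx mult.assoc flip: of_real_mult)
    qed (use L4 in auto)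
    finally show ?thesis .
  qed

  define v where "v \<xi> = Re (kap_sq_hat K \<xi>)" for \<xi>
  have hat_nonneg: "kap_sq_hat K \<xi> \<in> \<real>\<^sub>\<ge>\<^sub>0" for \<xi>
    unfolding kap_sq_hat_def kap_def
    by (rule fourier_transform_square_conv_nonneg[OF K]) (auto simp: symmetric)
  then have v: "kap_sq_hat K \<xi> = of_real (v \<xi>)" "0 \<le> v \<xi>" for \<xi>
    by (auto simp: v_def complex_nonneg_Reals_iff complex_eq_iff)
  have v0: "v 0 = kap_norm_sq K"
    by (simp add: v_def kap_sq_hat_def fourier_transform_0 kap_norm_sq_def del: of_real_power)
  have v_even: "v (- \<xi>) = v \<xi>" for \<xi>
    unfolding v_def kap_sq_hat_def fourier_transform_reflect[symmetric] by (simp add: kap_even)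

  have Sigma_eq: "Sigma_q K q h = 1 / real q * (\<Sum>n\<in>{-M..M}. (kap K (of_int n / (real q * h)))\<^sup>2)"
    if "1 \<le> q" "0 < h" "h < 1/4" "2 * (real q * h) \<le> of_int M" for q h M
    unfolding Sigma_q_def
    using that lip_supp_eq_0[OF kap]
    by (subst sum_fold_residues[where g = "\<lambda>x. (kap K x)\<^sup>2" and A = 2 and M = M]) (auto simp: kap_even)

  have scaled: "lip_supp (L3 / T) (2 * T) (\<lambda>x. complex_of_real ((kap K (x / T))\<^sup>2))"
    and scaled_hat: "fourier_transform (\<lambda>x. complex_of_real ((kap K (x / T))\<^sup>2)) \<xi> = of_real (T * v (\<xi> * T))"
    if "0 < T" for T \<xi>
    using lip_supp_of_real[OF lip_supp_scale[OF kap2 that]]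
      fourier_transform_scale[OF that, of "\<lambda>x. complex_of_real ((kap K x)\<^sup>2)" \<xi>] v(1)[of "\<xi> * T"]
    by (auto simp: kap_sq_hat_def)

  have Sigma_has_sum: "((\<lambda>k. h * v (of_int k * (real q * h))) has_sum Sigma_q K q h) UNIV"
    if q: "1 \<le> q" and h: "0 < h" "h < 1/4" for q h
  proof -
    define T where "T = real q * h"
    have T: "0 < T" using q h by (simp add: T_def)
    define M where "M = \<lceil>2 * T + 1/2\<rceil>"
    have M: "2 * T + 1/2 \<le> of_int M" by (simp add: M_def)
    have "(\<lambda>N. \<Sum>k\<in>{- int N..int N}. complex_of_real (T * v (of_int k * T)))
        \<longlonglongrightarrow> (\<Sum>n\<in>{-M..M}. complex_of_real ((kap K (of_int n / T))\<^sup>2))"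
      using poisson_summation[OF scaled[OF T] M] unfolding scaled_hat[OF T] .
    then have "(\<lambda>N. \<Sum>k\<in>{- int N..int N}. T * v (of_int k * T))
        \<longlonglongrightarrow> (\<Sum>n\<in>{-M..M}. (kap K (of_int n / T))\<^sup>2)"
      by (simp only: of_real_sum[symmetric] tendsto_of_real_iff)
    then have "((\<lambda>k. T * v (of_int k * T)) has_sum (\<Sum>n\<in>{-M..M}. (kap K (of_int n / T))\<^sup>2)) UNIV"
      using v T by (intro has_sum_symmetric_nonneg) auto
    \<comment> \<open>The dilation contributes a factor T = qh to each transform; the weight 1/q of
      \<open>Sigma_q\<close> turns it into \<open>h\<close>.\<close>
    from has_sum_cmult_right[OF this, of "1 / real q"] show ?thesis
      using q h M Sigma_eq[of q h M] by (simp add: T_def)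
  qed

  \<comment> \<open>One term kept from each representation: r = 0 contributes \<kappa>(0)^2 / q, and
    k = 0 contributes \<open>h * kap_norm_sq K\<close>.\<close>
  have Sigma_ge: "(RK K)\<^sup>2 / real q \<le> Sigma_q K q h" "h * kap_norm_sq K \<le> Sigma_q K q h"
    if q: "1 \<le> q" and h: "0 < h" "h < 1/4" for q h
  proof -
    have "(\<Sum>r\<in>{0}. (kap K (min (real r) (real q - real r) / (real q * h)))\<^sup>2)
        \<le> (\<Sum>r<q. (kap K (min (real r) (real q - real r) / (real q * h)))\<^sup>2)"
      using q by (intro sum_mono2) auto
    then show "(RK K)\<^sup>2 / real q \<le> Sigma_q K q h"
      using q by (simp add: Sigma_q_def RK_kap divide_right_mono)
    show "h * kap_norm_sq K \<le> Sigma_q K q h"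
      using finite_sum_le_has_sum[OF Sigma_has_sum[OF q h], of "{0}"] v(2) h by (simp add: v0)
  qed

  have main: "(\<lambda>k::int. kap_sq_hat K (real_of_int k * real q * h)) summable_on UNIV \<and>
        complex_of_real (Sigma_q K q h) =
          complex_of_real h * (\<Sum>\<^sub>\<infinity>k::int. kap_sq_hat K (real_of_int k * real q * h)) \<and>
        complex_of_real (Sigma_q K q h) =
          complex_of_real (h * kap_norm_sq K) +
          2 * complex_of_real h * (\<Sum>\<^sub>\<infinity>k\<in>{1::nat..}. kap_sq_hat K (real k * real q * h)) \<and>
        (\<forall>k::int. kap_sq_hat K (real_of_int k * real q * h) \<in> \<real>\<^sub>\<ge>\<^sub>0) \<and>
        r_q K q h \<le> min (real q) (c_const K / h) \<and>
        (real q * h < 1 / 2 \<longrightarrow> r_q K q h = real q)"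
    if q: "1 \<le> q" and h: "0 < h" "h < 1/4" for q :: nat and h :: real
  proof (intro conjI allI impI)
    have "((\<lambda>k. inverse h * (h * v (of_int k * (real q * h)))) has_sum inverse h * Sigma_q K q h) UNIV"
      by (rule has_sum_cmult_right[OF Sigma_has_sum[OF q h]])
    then have "((\<lambda>k. complex_of_real (v (of_int k * (real q * h)))) has_sum
        complex_of_real (inverse h * Sigma_q K q h)) UNIV"
      using h by (intro has_sum_of_real) (simp add: field_simps)
    then have sum: "((\<lambda>k. kap_sq_hat K (of_int k * real q * h)) has_sum
        complex_of_real (inverse h * Sigma_q K q h)) UNIV"
      by (simp add: v(1) mult.assoc)
    show summable: "(\<lambda>k::int. kap_sq_hat K (real_of_int k * real q * h)) summable_on UNIV"
      using sum by (rule has_sum_imp_summable)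
    show Sigma: "complex_of_real (Sigma_q K q h) =
          complex_of_real h * (\<Sum>\<^sub>\<infinity>k::int. kap_sq_hat K (real_of_int k * real q * h))"
      using h by (simp add: infsumI[OF sum])
    show "complex_of_real (Sigma_q K q h) = complex_of_real (h * kap_norm_sq K) +
        2 * complex_of_real h * (\<Sum>\<^sub>\<infinity>k\<in>{1::nat..}. kap_sq_hat K (real k * real q * h))"
      unfolding Sigma
      by (subst infsum_int_even[OF summable])
         (use v_even in \<open>auto simp: v(1) v0 algebra_simps\<close>)
    show "kap_sq_hat K (real_of_int k * real q * h) \<in> \<real>\<^sub>\<ge>\<^sub>0" for k by (rule hat_nonneg)
    have pos: "0 < Sigma_q K q h"
      using Sigma_ge(2)[OF q h] norm_pos h by (meson less_le_trans mult_pos_pos)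
    have "(RK K)\<^sup>2 \<le> real q * Sigma_q K q h"
      using Sigma_ge(1)[OF q h] q by (simp add: field_simps)
    moreover have "(RK K)\<^sup>2 / Sigma_q K q h \<le> (RK K)\<^sup>2 / (h * kap_norm_sq K)"
      using Sigma_ge(2)[OF q h] pos norm_pos h by (intro divide_left_mono) auto
    ultimately show "r_q K q h \<le> min (real q) (c_const K / h)"
      using pos by (simp add: r_q_def c_const_def divide_le_eq mult.commute)
    assume qh: "real q * h < 1/2"
    \<comment> \<open>Here 2qh < 1, so the range \<open>M = 1\<close> is admissible. The points n =
      -1 and n = 1 fall outside the support of \<kappa>, since 1/(qh) > 2.\<close>
    have "Sigma_q K q h = 1 / real q * (\<Sum>n\<in>{-1..1}. (kap K (of_int n / (real q * h)))\<^sup>2)"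
      using qh q h by (intro Sigma_eq) auto
    also have "(\<Sum>n\<in>{-1..1}. (kap K (of_int n / (real q * h)))\<^sup>2) = (\<Sum>n\<in>{0::int}. (kap K (of_int n / (real q * h)))\<^sup>2)"
    proof (rule sum.mono_neutral_right)
      show "\<forall>n\<in>{-1..1} - {0::int}. (kap K (of_int n / (real q * h)))\<^sup>2 = 0"
      proof
        fix n :: int assume n: "n \<in> {-1..1} - {0}"
        then have "\<bar>real_of_int n\<bar> = 1" by auto
        then have "2 < \<bar>real_of_int n / (real q * h)\<bar>"
          using qh q h by (simp add: abs_mult field_simps)
        then show "(kap K (of_int n / (real q * h)))\<^sup>2 = 0" using lip_supp_eq_0[OF kap] by simp
      qed
    qed auto
    finally show "r_q K q h = real q"
      using RK_pos by (simp add: r_q_def RK_kap)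
  qed

  have "((\<lambda>(q, h). Sigma_q K q h / h) \<longlongrightarrow> kap_norm_sq K) qh_at_top"
  proof -
    \<comment> \<open>For M = \<lceil>2T + 1/2\<rceil> the range has 2M + 1 \<le> 4T + 5 terms and
      the Lipschitz constant is \<open>L3 / T\<close>, so the lattice sum errs by at most (4T + 5)
      L3 / T. As \<open>Sigma_q K q h / h\<close> is that sum divided by \<open>T\<close>, one more
      division gives \<open>E T\<close>. The bound depends on q and h through qh alone, which is
      what makes the joint limit possible.\<close>
    define E where "E T = 4 * L3 * inverse T + 5 * L3 * (inverse T * inverse T)" for T
    have top: "filterlim (\<lambda>(q, h). real q * h) at_top qh_at_top"
      unfolding qh_at_top_def
      by (rule filterlim_mono[OF filterlim_filtercomap]) auto
    have inv: "((\<lambda>T::real. inverse T) \<longlongrightarrow> 0) at_top"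
      by (rule tendsto_inverse_0_at_top) (rule filterlim_ident)
    have "(E \<longlongrightarrow> 4 * L3 * 0 + 5 * L3 * (0 * 0)) at_top"
      unfolding E_def by (intro tendsto_intros inv)
    then have "(E \<longlongrightarrow> 0) at_top" by simp
    from filterlim_compose[OF this top] have E: "((\<lambda>p. E (case p of (q, h) \<Rightarrow> real q * h)) \<longlongrightarrow> 0) qh_at_top" .
    have "\<forall>\<^sub>F p in qh_at_top. norm ((case p of (q, h) \<Rightarrow> Sigma_q K q h / h) - kap_norm_sq K)
        \<le> E (case p of (q, h) \<Rightarrow> real q * h)"
    proof -
      have "\<forall>\<^sub>F p in qh_at_top. p \<in> {(q, h). 1 \<le> q \<and> 0 < h \<and> h < 1 / 4}"
        unfolding qh_at_top_def by (simp add: eventually_inf_principal)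
      then show ?thesis
      proof (rule eventually_mono, clarify)
        fix q :: nat and h :: real assume q: "1 \<le> q" and h: "0 < h" "h < 1/4"
        define T where "T = real q * h"
        have T: "0 < T" using q h by (simp add: T_def)
        define M where "M = \<lceil>2 * T + 1/2\<rceil>"
        have M: "2 * T + 1/2 \<le> of_int M" by (simp add: M_def)
        have M': "of_int M \<le> 2 * T + 2" unfolding M_def by linarith
        define s where "s = (\<Sum>n\<in>{-M..M}. (kap K (of_int n / T))\<^sup>2)"
        have "cmod (of_real (T * v (0 * T)) - (\<Sum>n\<in>{-M..M}. complex_of_real ((kap K (of_int n / T))\<^sup>2)))
            \<le> real (nat (2 * M + 1)) * (L3 / T)"
          using riemann_sum_error[OF scaled[OF T] M] unfolding scaled_hat[OF T] .
        moreover have "of_real (T * v (0 * T)) - (\<Sum>n\<in>{-M..M}. complex_of_real ((kap K (of_int n / T))\<^sup>2))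
            = complex_of_real (T * kap_norm_sq K - s)"
          by (simp add: v0 s_def)
        ultimately have "\<bar>T * kap_norm_sq K - s\<bar> \<le> real (nat (2 * M + 1)) * (L3 / T)"
          by (simp only: norm_of_real)
        also have "\<dots> \<le> (4 * T + 5) * (L3 / T)"
        proof (rule mult_right_mono)
          have "0 \<le> M" using M T by linarith
          then show "real (nat (2 * M + 1)) \<le> 4 * T + 5" using M' by simp
        qed (use lip_supp_nonneg[OF kap2] T in auto)
        finally have *: "\<bar>T * kap_norm_sq K - s\<bar> \<le> (4 * T + 5) * (L3 / T)" .
        have "Sigma_q K q h = 1 / real q * s"
          unfolding s_def T_def using q h M by (intro Sigma_eq) (auto simp: T_def)
        then have "Sigma_q K q h / h = s / T" by (simp add: T_def)
        then have "Sigma_q K q h / h - kap_norm_sq K = - ((T * kap_norm_sq K - s) / T)"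
          using T by (simp add: field_simps)
        then have "norm (Sigma_q K q h / h - kap_norm_sq K) = \<bar>T * kap_norm_sq K - s\<bar> / T"
          using T by (simp only: real_norm_def abs_minus_cancel abs_divide abs_of_pos)
        also have "\<dots> \<le> (4 * T + 5) * (L3 / T) / T"
          using * T by (intro divide_right_mono) auto
        also have "\<dots> = E T" using T by (simp add: E_def field_simps)
        finally show "norm (Sigma_q K q h / h - kap_norm_sq K) \<le> E (real q * h)" by (simp add: T_def)
      qed
    qed
    then have "((\<lambda>p. (case p of (q, h) \<Rightarrow> Sigma_q K q h / h) - kap_norm_sq K) \<longlongrightarrow> 0) qh_at_top"
      by (rule Lim_null_comparison[OF _ E])
    then show ?thesis by (rule LIM_zero_cancel)
  qed
  then have "((\<lambda>p. (RK K)\<^sup>2 / (case p of (q, h) \<Rightarrow> Sigma_q K q h / h)) \<longlongrightarrow> c_const K) qh_at_top"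
    unfolding c_const_def using norm_pos by (intro tendsto_intros) auto
  moreover have "(\<lambda>p. (RK K)\<^sup>2 / (case p of (q, h) \<Rightarrow> Sigma_q K q h / h)) = (\<lambda>(q, h). r_q K q h * h)"
    by (auto simp: r_q_def)
  ultimately have limit: "((\<lambda>(q, h). r_q K q h * h) \<longlongrightarrow> c_const K) qh_at_top" by simp

  have c: "c_const K = (LINT x|lborel. (K x)\<^sup>2)\<^sup>2 / (LINT \<xi>|lborel. (cmod (K_hat K \<xi>)) ^ 4)"
    by (simp add: c_const_def RK_def plancherel)
  show ?thesis
    using RK_kap plancherel c main limit by blast
qed

end
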